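(* Let $\mathcal{E}$ be an arbitrary infinitesimal divisible unital qubit channel. Then there exist at least one L-divisible Pauli channel $\tilde{\mathcal{E}}$ and two unitary conjugations $\mathcal{U}_1$ and $\mathcal{U}_2$ such that $$\mathcal{E}=\mathcal{U}_1\,\tilde{\mathcal{E}}\,\mathcal{U}_2 .$$ Moreover, if $\mathcal{E}$ is invertible, then $\tilde{\mathcal{E}}=e^{L}$ with $L$ a Lindblad generator.
   Context: A qubit channel is a linear, completely positive, trace-preserving (CPTP) map on $\mathbb{C}^{2\times 2}$; it is unital if it maps $\mathbb{1}$ to $\mathbb{1}$. A unitary conjugation is a map $\rho\mapsto U\rho U^\dagger$ with $U$ unitary. A Pauli channel is a channel $\rho\mapsto\sum_{i=0}^{3}p_i\sigma_i\rho\sigma_i$ with $\sigma_0=\mathbb{1}$, $\sigma_1,\sigma_2,\sigma_3$ the Pauli matrices, $p_i\ge0$, $\sum_ip_i=1$. Products of maps denote composition. Infinitesimal divisible (in CPTP): let $\mathcal{L}_{\mathrm{CP}}$ be the set of channels $\mathcal{E}$ such that for every $\epsilon>0$ there exist finitely many channels $\mathcal{E}_i$ (CPTP) with $|\mathcal{E}_i-\mathrm{id}|<\epsilon$ and $\mathcal{E}=\prod_i\mathcal{E}_i$. A channel is infinitesimal divisible if it belongs to the closure of $\mathcal{L}_{\mathrm{CP}}$. A Lindblad generator is a linear map $L[\rho]=\mathrm{i}[\rho,H]+\sum_{i,j}G_{ij}\left(F_i\rho F_j^\dagger-\tfrac12\{F_j^\dagger F_i,\rho\}\right)$ with $H$,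 $G$ hermitian, $G\ge0$, and $F_i$ operators on the Hilbert space. A channel is L-divisible if it belongs to the closure of the set of non-singular channels $\mathcal{E}$ for which there is a Lindblad generator $L$ with $\mathcal{E}=e^{L}$. *)

theory Defs
  imports "HOL-Analysis.Analysis"
begin

type_synonym qop = "complex ^ 2 ^ 2"

(* HOL-Analysis has only real-linear bounded maps, with the operator norm and its topology;
   complex linearity is a separate conjunct in the definition of a channel. *)
type_synonym qmap = "qop \<Rightarrow>\<^sub>L qop"

definition cscale :: "complex \<Rightarrow> qop \<Rightarrow> qop" where
  "cscale c A = map_matrix ((*) c) A"

definition dagger :: "qop \<Rightarrow> qop" where
  "dagger A = map_matrix cnj (transpose A)"

definition hermitian :: "qop \<Rightarrow> bool" where
  "hermitian A \<longleftrightarrow> dagger A = A"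

definition unitary :: "qop \<Rightarrow> bool" where
  "unitary U \<longleftrightarrow> U ** dagger U = mat 1 \<and> dagger U ** U = mat 1"

(* Meant for finite I only. Hermiticity makes the quadratic form real, so comparing its real part
   with 0 suffices. *)
definition psd :: "'i set \<Rightarrow> ('i \<Rightarrow> 'i \<Rightarrow> complex) \<Rightarrow> bool" where
  "psd I Q \<longleftrightarrow>
     (\<forall>i\<in>I. \<forall>j\<in>I. Q j i = cnj (Q i j)) \<and>
     (\<forall>v. 0 \<le> Re (\<Sum>i\<in>I. \<Sum>j\<in>I. cnj (v i) * Q i j * v j))"

(* An operator on C^n (x) C^2 is an n-by-n array X of 2-by-2 blocks, i.e. a matrix indexed by
   {..<n} x {1,2}; the map id_n (x) E applies E to each block. *)
definition block_psd :: "nat \<Rightarrow> (nat \<Rightarrow> nat \<Rightarrow> qop) \<Rightarrow> bool" where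
  "block_psd n X \<longleftrightarrow>
     psd ({..<n} \<times> (UNIV :: 2 set)) (\<lambda>(i, a) (j, b). X i j $ a $ b)"

definition completely_positive :: "qmap \<Rightarrow> bool" where
  "completely_positive E \<longleftrightarrow>
     (\<forall>n X. block_psd n X \<longrightarrow> block_psd n (\<lambda>i j. blinfun_apply E (X i j)))"

definition trace_preserving :: "qmap \<Rightarrow> bool" where
  "trace_preserving E \<longleftrightarrow> (\<forall>A. trace (blinfun_apply E A) = trace A)"

definition channel :: "qmap \<Rightarrow> bool" where
  "channel E \<longleftrightarrow>
     Vector_Spaces.linear cscale cscale (blinfun_apply E) \<and>
     completely_positive E \<and> trace_preserving E"

definition unital :: "qmap \<Rightarrow> bool" where
  "unital E \<longleftrightarrow> blinfun_apply E (mat 1) = mat 1"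

definition unitary_conjugation :: "qmap \<Rightarrow> bool" where
  "unitary_conjugation E \<longleftrightarrow>
     (\<exists>U. unitary U \<and> (\<forall>\<rho>. blinfun_apply E \<rho> = U ** \<rho> ** dagger U))"

definition pauli :: "nat \<Rightarrow> qop" where
  "pauli i =
     (if i = 0 then mat 1
      else if i = 1 then vector [vector [0, 1], vector [1, 0]]
      else if i = 2 then vector [vector [0, -\<i>], vector [\<i>, 0]]
      else vector [vector [1, 0], vector [0, -1]])"

definition pauli_channel :: "qmap \<Rightarrow> bool" where
  "pauli_channel E \<longleftrightarrow> channel E \<and>
     (\<exists>p :: nat \<Rightarrow> real. (\<forall>i<4. 0 \<le> p i) \<and> (\<Sum>i<4. p i) = 1 \<and>
        (\<forall>\<rho>. blinfun_apply E \<rho> = (\<Sum>i<4. p i *\<^sub>R (pauli i ** \<rho> ** pauli i))))"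

(* The set of channels whose closure consists of the infinitesimal divisible maps. *)
definition L_CP :: "qmap set" where
  "L_CP = {E. channel E \<and>
     (\<forall>\<epsilon>>0. \<exists>Es :: qmap list.
        (\<forall>T\<in>set Es. channel T \<and> norm (T - id_blinfun) < \<epsilon>) \<and>
        E = foldr (o\<^sub>L) Es id_blinfun)}"

definition infinitesimal_divisible :: "qmap \<Rightarrow> bool" where
  "infinitesimal_divisible E \<longleftrightarrow> channel E \<and> E \<in> closure L_CP"

definition lindblad_generator :: "qmap \<Rightarrow> bool" where
  "lindblad_generator L \<longleftrightarrow>
     (\<exists>(H :: qop) (m :: nat) (F :: nat \<Rightarrow> qop) (G :: nat \<Rightarrow> nat \<Rightarrow> complex).
        hermitian H \<and> psd {..<m} G \<and>
        (\<forall>\<rho>. blinfun_apply L \<rho> =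
           cscale \<i> (\<rho> ** H - H ** \<rho>) +
           (\<Sum>i<m. \<Sum>j<m. cscale (G i j)
              (F i ** \<rho> ** dagger (F j)
               - (1/2) *\<^sub>R (dagger (F j) ** F i ** \<rho> + \<rho> ** (dagger (F j) ** F i))))))"

(* The library's exp needs a Banach algebra type, and bounded linear maps are not an instance. *)
definition qexp :: "qmap \<Rightarrow> qmap" where
  "qexp L = (\<Sum>n. (((o\<^sub>L) L) ^^ n) id_blinfun /\<^sub>R fact n)"

definition singular :: "qmap \<Rightarrow> bool" where
  "singular E \<longleftrightarrow> \<not> bij (blinfun_apply E)"

definition L_divisible :: "qmap \<Rightarrow> bool" where
  "L_divisible E \<longleftrightarrow> channel E \<and>
     E \<in> closure {T. channel T \<and> \<not> singular T \<and> (\<exists>L. lindblad_generator L \<and> T = qexp L)}"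

end

theory Submission
  imports Defs
begin

text \<open>The Bloch matrix of a composition of channels is the product of the Bloch matrices,
  whatever the translation parts. For a single channel with non-negative singular values the Choi
  matrix gives \<open>s\<^sub>i + s\<^sub>j \<le> 1 + s\<^sub>k\<close>, hence \<open>s\<^sub>i s\<^sub>j - s\<^sub>k \<le> (1 - s\<^sub>i) (1 - s\<^sub>j)\<close>: close to the
  identity, the inequality \<open>s\<^sub>i s\<^sub>j \<le> s\<^sub>k\<close> fails only to second order, and the error is absorbed
  by a factor \<open>det powr \<eta>\<close> with arbitrarily small \<open>\<eta>\<close>. The bound
  \<open>det powr (1 + \<eta>) \<le> s\<^sub>m\<^sub>i\<^sub>n\<^sup>2\<close> is multiplicative, so it passes to products of channels near the
  identity; letting \<open>\<eta>\<close> tend to 0 and taking closures, \<open>s\<^sub>i s\<^sub>j \<le> s\<^sub>k\<close> holds for every infinitesimal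
  divisible channel. A singular value decomposition by unitary conjugations turns a unital channel
  into a Pauli channel with eigenvalues \<open>1, s\<^sub>1, s\<^sub>2, s\<^sub>3\<close>, and if these are positive the inequalities
  say exactly that the Pauli-diagonal logarithm has non-negative Lindblad rates.\<close>

section \<open>Bloch coordinates\<close>

lemma cscale_component [simp]: "cscale c A $ i $ j = c * A $ i $ j"
  by (simp add: cscale_def map_matrix_def)

lemma dagger_component [simp]: "dagger A $ i $ j = cnj (A $ j $ i)"
  by (simp add: dagger_def map_matrix_def transpose_def)

lemma qop_eq_iff:
  "A = B \<longleftrightarrow> A $ 1 $ 1 = B $ 1 $ 1 \<and> A $ 1 $ 2 = B $ 1 $ 2 \<and> A $ 2 $ 1 = B $ 2 $ 1 \<and> A $ 2 $ 2 = B $ 2 $ 2"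
  for A B :: qop
  by (simp add: vec_eq_iff forall_2)

lemma qop_mult_component: "(A ** B) $ i $ j = A $ i $ 1 * B $ 1 $ j + A $ i $ 2 * B $ 2 $ j"
  for A B :: qop
  by (simp add: matrix_matrix_mult_def sum_2)

lemma trace_qop: "trace A = A $ 1 $ 1 + A $ 2 $ 2" for A :: qop
  by (simp add: trace_def sum_2)

lemma mat_qop_component:
  "(mat c :: qop) $ 1 $ 1 = c" "(mat c :: qop) $ 1 $ 2 = 0"
  "(mat c :: qop) $ 2 $ 1 = 0" "(mat c :: qop) $ 2 $ 2 = c"
  by (simp_all add: mat_def)

lemma pauli_simps:
  "pauli 0 = mat 1"
  "pauli 1 = vector [vector [0, 1], vector [1, 0]]"
  "pauli (Suc 0) = vector [vector [0, 1], vector [1, 0]]"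
  "pauli 2 = vector [vector [0, -\<i>], vector [\<i>, 0]]"
  "pauli 3 = vector [vector [1, 0], vector [0, -1]]"
  by (simp_all add: pauli_def)

lemmas qop_simps = qop_eq_iff qop_mult_component trace_qop mat_qop_component pauli_simps

lemma dagger_mult: "dagger (A ** B) = dagger B ** dagger A"
  by (simp add: qop_simps)

lemma dagger_dagger [simp]: "dagger (dagger A) = A"
  by (simp add: qop_simps)

lemma dagger_mat_1 [simp]: "dagger (mat 1) = mat 1"
  by (simp add: qop_simps)

lemma qop_trace_mult_commute: "trace (A ** B) = trace (B ** A)" for A B :: qop
  by (simp add: qop_simps)

lemma vector_space_cscale: "vector_space cscale"
  by unfold_locales (simp_all add: qop_eq_iff algebra_simps)

lemma cscale_linear_iff:
  "Vector_Spaces.linear cscale cscale f \<longleftrightarrow>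
     (\<forall>A B. f (A + B) = f A + f B) \<and> (\<forall>c A. f (cscale c A) = cscale c (f A))"
  by (simp add: Vector_Spaces.linear_iff vector_space_cscale)

definition bloch_op :: "real ^ 3 \<Rightarrow> qop" where
  "bloch_op x = x $ 1 *\<^sub>R pauli 1 + x $ 2 *\<^sub>R pauli 2 + x $ 3 *\<^sub>R pauli 3"

text \<open>Taking real parts gives a real-linear map on all operators that sees only the hermitian
  part of \<open>A\<close>.\<close>

definition bloch_vec :: "qop \<Rightarrow> real ^ 3" where
  "bloch_vec A = vector [Re (trace (pauli 1 ** A)) / 2, Re (trace (pauli 2 ** A)) / 2,
     Re (trace (pauli 3 ** A)) / 2]"

text \<open>This records only the linear part of the affine action of a channel on the Bloch ball;
  the translation is carried by the image of \<open>mat 1\<close>.\<close>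

definition bloch_matrix :: "qmap \<Rightarrow> real ^ 3 ^ 3" where
  "bloch_matrix E = matrix (\<lambda>x. bloch_vec (blinfun_apply E (bloch_op x)))"

lemma bloch_op_component:
  "bloch_op x $ 1 $ 1 = x $ 3" "bloch_op x $ 1 $ 2 = Complex (x $ 1) (- x $ 2)"
  "bloch_op x $ 2 $ 1 = Complex (x $ 1) (x $ 2)" "bloch_op x $ 2 $ 2 = - x $ 3"
  by (simp_all add: bloch_op_def pauli_simps complex_eq_iff)

lemma bloch_vec_component:
  "bloch_vec A $ 1 = Re (A $ 1 $ 2 + A $ 2 $ 1) / 2"
  "bloch_vec A $ 2 = Im (A $ 2 $ 1 - A $ 1 $ 2) / 2"
  "bloch_vec A $ 3 = Re (A $ 1 $ 1 - A $ 2 $ 2) / 2"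
  by (simp_all add: bloch_vec_def qop_simps)

lemma vec3_eq_iff: "x = y \<longleftrightarrow> x $ 1 = y $ 1 \<and> x $ 2 = y $ 2 \<and> x $ 3 = y $ 3"
  for x y :: "'a ^ 3"
  by (simp add: vec_eq_iff forall_3)

lemma bloch_vec_bloch_op [simp]: "bloch_vec (bloch_op x) = x"
  by (simp add: vec3_eq_iff bloch_vec_component bloch_op_component)

lemma bloch_op_bloch_vec:
  assumes "hermitian A" "trace A = 0"
  shows "bloch_op (bloch_vec A) = A"
proof -
  have "A $ 2 $ 2 = - A $ 1 $ 1"
    using assms(2) by (simp add: trace_qop add_eq_0_iff)
  moreover have "cnj (A $ 1 $ 1) = A $ 1 $ 1" "A $ 2 $ 1 = cnj (A $ 1 $ 2)"
    using assms(1) unfolding hermitian_def qop_eq_iff by auto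
  ultimately show ?thesis
    by (auto simp: qop_eq_iff bloch_op_component bloch_vec_component complex_eq_iff)
qed

lemma linear_bloch_op: "linear bloch_op"
  by (rule linearI) (simp_all add: bloch_op_def algebra_simps)

lemma linear_bloch_vec: "linear bloch_vec"
  by (rule linearI) (simp_all add: vec3_eq_iff bloch_vec_component field_simps)

lemma trace_bloch_op [simp]: "trace (bloch_op x) = 0"
  by (simp add: trace_qop bloch_op_component)

section \<open>Frobenius norms in Bloch coordinates\<close>

lemma norm_qop: "norm A ^ 2 = (cmod (A $ 1 $ 1))\<^sup>2 + (cmod (A $ 1 $ 2))\<^sup>2 + (cmod (A $ 2 $ 1))\<^sup>2 + (cmod (A $ 2 $ 2))\<^sup>2"
  for A :: qop
  by (simp add: norm_vec_def L2_set_def sum_2)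

lemma norm_vec3: "norm x ^ 2 = (x $ 1)\<^sup>2 + (x $ 2)\<^sup>2 + (x $ 3)\<^sup>2" for x :: "real ^ 3"
  by (simp add: norm_vec_def L2_set_def sum_3)

lemma norm_bloch_op: "norm (bloch_op x) = sqrt 2 * norm x"
proof -
  have "norm (bloch_op x) ^ 2 = (sqrt 2 * norm x) ^ 2"
    by (simp add: norm_qop bloch_op_component norm_vec3 power_mult_distrib cmod_power2)
  then show ?thesis
    by (simp add: power2_eq_iff_nonneg)
qed

text \<open>Each Bloch coordinate is half a sum or half a difference of two real entries of
  \<open>A\<close>, so its square is at most the mean of their squares.\<close>

lemma norm_bloch_vec_le: "sqrt 2 * norm (bloch_vec A) \<le> norm A"
proof -
  have aux: "((a + b) / 2)\<^sup>2 \<le> (a\<^sup>2 + b\<^sup>2) / 2" "((a - b) / 2)\<^sup>2 \<le> (a\<^sup>2 + b\<^sup>2) / 2" for a b :: real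
    using zero_le_power2[of "a - b"] zero_le_power2[of "a + b"]
    by (simp_all add: power2_sum power2_diff power_divide)
  have "(sqrt 2 * norm (bloch_vec A)) ^ 2 \<le> norm A ^ 2"
    using aux(1)[of "Re (A $ 1 $ 2)" "Re (A $ 2 $ 1)"] aux(2)[of "Im (A $ 2 $ 1)" "Im (A $ 1 $ 2)"]
      aux(2)[of "Re (A $ 1 $ 1)" "Re (A $ 2 $ 2)"]
      zero_le_power2[of "Im (A $ 1 $ 1)"] zero_le_power2[of "Im (A $ 2 $ 2)"]
    unfolding norm_qop norm_vec3 power_mult_distrib cmod_power2 bloch_vec_component
    by (simp add: algebra_simps)
       (smt (verit) zero_le_power2 field_sum_of_halves)
  then show ?thesis
    by (rule power2_le_imp_le) simp
qed

lemma bloch_matrix_mult: "bloch_matrix E *v x = bloch_vec (blinfun_apply E (bloch_op x))"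
proof -
  have "linear (\<lambda>x. bloch_vec (blinfun_apply E (bloch_op x)))"
    using linear_compose[OF linear_compose[OF linear_bloch_op
        bounded_linear.linear[OF blinfun.bounded_linear_right]] linear_bloch_vec]
    by (simp add: o_def)
  from matrix_works[OF this[folded linear_matrix_vector_mul_eq]] show ?thesis
    by (simp add: bloch_matrix_def)
qed

section \<open>Complete positivity and channels\<close>

lemma psd_gram:
  fixes f :: "'i \<Rightarrow> 'k \<Rightarrow> complex"
  shows "psd I (\<lambda>i j. \<Sum>c\<in>C. f i c * cnj (f j c))"
  unfolding psd_def
proof (intro conjI ballI allI)
  fix v :: "'i \<Rightarrow> complex"
  \<comment> \<open>The quadratic form at \<open>v\<close> turns into the sum of the squared moduli
    of the numbers \<open>z c\<close>.\<close>
  define z where "z c = (\<Sum>i\<in>I. cnj (v i) * f i c)" for c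
  have "(\<Sum>i\<in>I. \<Sum>j\<in>I. cnj (v i) * (\<Sum>c\<in>C. f i c * cnj (f j c)) * v j) =
      (\<Sum>i\<in>I. \<Sum>j\<in>I. \<Sum>c\<in>C. (cnj (v i) * f i c) * cnj (cnj (v j) * f j c))"
    by (simp add: sum_distrib_left sum_distrib_right mult_ac)
  also have "\<dots> = (\<Sum>i\<in>I. \<Sum>c\<in>C. \<Sum>j\<in>I. (cnj (v i) * f i c) * cnj (cnj (v j) * f j c))"
    by (intro sum.cong refl sum.swap)
  also have "\<dots> = (\<Sum>c\<in>C. \<Sum>i\<in>I. \<Sum>j\<in>I. (cnj (v i) * f i c) * cnj (cnj (v j) * f j c))"
    by (rule sum.swap)
  also have "\<dots> = (\<Sum>c\<in>C. z c * cnj (z c))"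
    unfolding z_def by (simp only: cnj_sum sum_product)
  finally show "0 \<le> Re (\<Sum>i\<in>I. \<Sum>j\<in>I. cnj (v i) * (\<Sum>c\<in>C. f i c * cnj (f j c)) * v j)"
    by (simp add: complex_mult_cnj sum_nonneg flip: of_real_power of_real_add)
qed (simp add: mult.commute)

lemma psd_weighted_sum:
  fixes p :: "'k \<Rightarrow> real" and Q :: "'k \<Rightarrow> 'i \<Rightarrow> 'i \<Rightarrow> complex"
  assumes pos: "\<And>k. k \<in> S \<Longrightarrow> 0 \<le> p k" and psd: "\<And>k. k \<in> S \<Longrightarrow> psd I (Q k)"
  shows "psd I (\<lambda>i j. \<Sum>k\<in>S. p k * Q k i j)"
  unfolding psd_def
proof (intro conjI ballI allI)
  fix i j assume "i \<in> I" "j \<in> I"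
  then have "cnj (Q k i j) = Q k j i" if "k \<in> S" for k
    using psd[OF that] by (metis psd_def)
  then show "(\<Sum>k\<in>S. p k * Q k j i) = cnj (\<Sum>k\<in>S. p k * Q k i j)"
    by simp
next
  fix v :: "'i \<Rightarrow> complex"
  have nonneg: "0 \<le> Re (\<Sum>i\<in>I. \<Sum>j\<in>I. cnj (v i) * Q k i j * v j)" if "k \<in> S" for k
    using psd[OF that] unfolding psd_def by (rule spec[OF conjunct2])
  have "(\<Sum>i\<in>I. \<Sum>j\<in>I. cnj (v i) * (\<Sum>k\<in>S. p k * Q k i j) * v j) =
      (\<Sum>i\<in>I. \<Sum>j\<in>I. \<Sum>k\<in>S. p k * (cnj (v i) * Q k i j * v j))"
    by (simp add: sum_distrib_left sum_distrib_right mult_ac)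
  also have "\<dots> = (\<Sum>i\<in>I. \<Sum>k\<in>S. \<Sum>j\<in>I. p k * (cnj (v i) * Q k i j * v j))"
    by (intro sum.cong refl sum.swap)
  also have "\<dots> = (\<Sum>k\<in>S. \<Sum>i\<in>I. \<Sum>j\<in>I. p k * (cnj (v i) * Q k i j * v j))"
    by (rule sum.swap)
  also have "\<dots> = (\<Sum>k\<in>S. p k * (\<Sum>i\<in>I. \<Sum>j\<in>I. cnj (v i) * Q k i j * v j))"
    by (simp add: sum_distrib_left)
  finally show "0 \<le> Re (\<Sum>i\<in>I. \<Sum>j\<in>I. cnj (v i) * (\<Sum>k\<in>S. p k * Q k i j) * v j)"
    using pos nonneg by (simp add: sum_nonneg)
qed

text \<open>A vector of the tensor product is split by its second index: \<open>v\<close> and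
  \<open>w\<close> hold the components for the index values 1 and 2.\<close>

definition block_form :: "nat \<Rightarrow> (nat \<Rightarrow> nat \<Rightarrow> qop) \<Rightarrow> (nat \<Rightarrow> complex) \<Rightarrow> (nat \<Rightarrow> complex) \<Rightarrow> complex" where
  "block_form n X v w = (\<Sum>i<n. \<Sum>j<n.
     cnj (v i) * X i j $ 1 $ 1 * v j + cnj (v i) * X i j $ 1 $ 2 * w j
     + cnj (w i) * X i j $ 2 $ 1 * v j + cnj (w i) * X i j $ 2 $ 2 * w j)"

lemma sum_times_UNIV_2: "(\<Sum>p\<in>A \<times> (UNIV :: 2 set). g p) = (\<Sum>i\<in>A. g (i, 1) + g (i, 2))"
  by (simp add: sum.cartesian_product' sum_2)

lemma block_psd_iff:
  "block_psd n X \<longleftrightarrow>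
     (\<forall>i<n. \<forall>j<n. \<forall>a b. cnj (X i j $ a $ b) = X j i $ b $ a) \<and>
     (\<forall>v w. 0 \<le> Re (block_form n X v w))"
proof -
  have form: "(\<Sum>p\<in>{..<n} \<times> UNIV. \<Sum>q\<in>{..<n} \<times> UNIV.
        cnj (u p) * (case p of (i, a) \<Rightarrow> \<lambda>(j, b). X i j $ a $ b) q * u q) =
      block_form n X (\<lambda>i. u (i, 1)) (\<lambda>i. u (i, 2))" for u :: "nat \<times> 2 \<Rightarrow> complex"
    unfolding sum_times_UNIV_2 block_form_def by (simp add: sum.distrib add_ac)
  have all: "(\<forall>u :: nat \<times> 2 \<Rightarrow> complex. 0 \<le> Re (block_form n X (\<lambda>i. u (i, 1)) (\<lambda>i. u (i, 2)))) \<longleftrightarrow>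
      (\<forall>v w. 0 \<le> Re (block_form n X v w))"
  proof (intro iffI allI)
    fix v w
    assume "\<forall>u :: nat \<times> 2 \<Rightarrow> complex. 0 \<le> Re (block_form n X (\<lambda>i. u (i, 1)) (\<lambda>i. u (i, 2)))"
    then show "0 \<le> Re (block_form n X v w)"
      by (drule_tac x = "\<lambda>(i, a). if a = 1 then v i else w i" in spec) simp
  qed simp
  have sym: "(\<forall>p\<in>{..<n} \<times> UNIV. \<forall>q\<in>{..<n} \<times> UNIV.
      (case q of (i, a) \<Rightarrow> \<lambda>(j, b). X i j $ a $ b) p =
        cnj ((case p of (i, a) \<Rightarrow> \<lambda>(j, b). X i j $ a $ b) q)) \<longleftrightarrow>
      (\<forall>i<n. \<forall>j<n. \<forall>a b. cnj (X i j $ a $ b) = X j i $ b $ a)"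
    (is "?L \<longleftrightarrow> ?R")
  proof
    assume L: ?L
    show ?R
    proof (intro allI impI)
      fix i j a b assume "i < n" "j < n"
      with L[rule_format, of "(i, a)" "(j, b)"] show "cnj (X i j $ a $ b) = X j i $ b $ a"
        by (simp only: prod.case mem_Times_iff fst_conv snd_conv lessThan_iff UNIV_I)
    qed
  next
    assume R: ?R
    show ?L
    proof (intro ballI)
      fix p q :: "nat \<times> 2" assume "p \<in> {..<n} \<times> UNIV" "q \<in> {..<n} \<times> UNIV"
      then show "(case q of (i, a) \<Rightarrow> \<lambda>(j, b). X i j $ a $ b) p =
          cnj ((case p of (i, a) \<Rightarrow> \<lambda>(j, b). X i j $ a $ b) q)"
        using R[rule_format, of "fst p" "fst q" "snd p" "snd q"]
        by (simp only: case_prod_beta mem_Times_iff lessThan_iff)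
    qed
  qed
  show ?thesis
    unfolding block_psd_def psd_def form all sym ..
qed

text \<open>The factors \<open>K\<close> move from the blocks onto the vector:
  \<open>dagger K\<close> acts on each pair \<open>(v i, w i)\<close>.\<close>

lemma block_form_conjugation:
  "block_form n (\<lambda>i j. K ** X i j ** dagger K) v w = block_form n X
     (\<lambda>i. cnj (K $ 1 $ 1) * v i + cnj (K $ 2 $ 1) * w i)
     (\<lambda>i. cnj (K $ 1 $ 2) * v i + cnj (K $ 2 $ 2) * w i)"
proof -
  have "cnj v1 * (K ** Y ** dagger K) $ 1 $ 1 * u1 + cnj v1 * (K ** Y ** dagger K) $ 1 $ 2 * u2
      + cnj v2 * (K ** Y ** dagger K) $ 2 $ 1 * u1 + cnj v2 * (K ** Y ** dagger K) $ 2 $ 2 * u2 =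
    cnj (cnj (K $ 1 $ 1) * v1 + cnj (K $ 2 $ 1) * v2) * Y $ 1 $ 1 * (cnj (K $ 1 $ 1) * u1 + cnj (K $ 2 $ 1) * u2)
      + cnj (cnj (K $ 1 $ 1) * v1 + cnj (K $ 2 $ 1) * v2) * Y $ 1 $ 2 * (cnj (K $ 1 $ 2) * u1 + cnj (K $ 2 $ 2) * u2)
      + cnj (cnj (K $ 1 $ 2) * v1 + cnj (K $ 2 $ 2) * v2) * Y $ 2 $ 1 * (cnj (K $ 1 $ 1) * u1 + cnj (K $ 2 $ 1) * u2)
      + cnj (cnj (K $ 1 $ 2) * v1 + cnj (K $ 2 $ 2) * v2) * Y $ 2 $ 2 * (cnj (K $ 1 $ 2) * u1 + cnj (K $ 2 $ 2) * u2)"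
    for Y :: qop and v1 v2 u1 u2
    unfolding qop_mult_component dagger_component complex_cnj_add complex_cnj_mult complex_cnj_cnj
    by algebra
  note summand = this
  show ?thesis
    unfolding block_form_def by (rule sum.cong[OF refl], rule sum.cong[OF refl], rule summand)
qed

lemma block_psd_conjugation:
  assumes "block_psd n X"
  shows "block_psd n (\<lambda>i j. K ** X i j ** dagger K)"
  unfolding block_psd_iff block_form_conjugation
proof (intro conjI allI impI)
  fix i j a b assume "i < n" "j < n"
  then have "cnj (X i j $ c $ d) = X j i $ d $ c" for c d
    using assms unfolding block_psd_iff by blast
  then show "cnj ((K ** X i j ** dagger K) $ a $ b) = (K ** X j i ** dagger K) $ b $ a"
    by (simp add: qop_mult_component algebra_simps)
next
  show "0 \<le> Re (block_form n X (\<lambda>i. cnj (K $ 1 $ 1) * v i + cnj (K $ 2 $ 1) * w i)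
     (\<lambda>i. cnj (K $ 1 $ 2) * v i + cnj (K $ 2 $ 2) * w i))" for v w
    using assms unfolding block_psd_iff by blast
qed

section \<open>Conjugations and basic properties of channels\<close>

definition conjugation :: "qop \<Rightarrow> qmap" where
  "conjugation K = Blinfun (\<lambda>A. K ** A ** dagger K)"

lemma bounded_linear_qop: "linear f \<Longrightarrow> bounded_linear f" for f :: "qop \<Rightarrow> qop"
  by (simp add: linear_conv_bounded_linear)

lemma conjugation_apply [simp]: "blinfun_apply (conjugation K) A = K ** A ** dagger K"
  unfolding conjugation_def
  by (subst bounded_linear_Blinfun_apply)
     (auto intro!: bounded_linear_qop linearI simp: qop_simps algebra_simps)

lemma unitary_dagger: "unitary U \<Longrightarrow> unitary (dagger U)"
  by (simp add: unitary_def)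

lemma unitary_mult: "unitary U \<Longrightarrow> unitary V \<Longrightarrow> unitary (U ** V)"
  unfolding unitary_def dagger_mult by (metis matrix_mul_assoc matrix_mul_rid)

lemma unitary_conjugation_conjugation: "unitary U \<Longrightarrow> unitary_conjugation (conjugation U)"
  by (auto simp: unitary_conjugation_def)

lemma conjugation_compose: "conjugation U o\<^sub>L conjugation V = conjugation (U ** V)"
  by (rule blinfun_eqI) (simp add: dagger_mult matrix_mul_assoc)

lemma conjugation_mat_1 [simp]: "conjugation (mat 1) = id_blinfun"
  by (rule blinfun_eqI) simp

lemma conjugation_inverse:
  assumes "unitary U"
  shows "conjugation U o\<^sub>L conjugation (dagger U) = id_blinfun"
    "conjugation (dagger U) o\<^sub>L conjugation U = id_blinfun"
  using assms by (simp_all add: conjugation_compose unitary_def)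

lemma channel_conjugation:
  assumes "unitary U"
  shows "channel (conjugation U)"
  unfolding channel_def
proof (intro conjI)
  show "Vector_Spaces.linear cscale cscale (blinfun_apply (conjugation U))"
    by (simp add: cscale_linear_iff blinfun.add_right) (simp add: qop_simps algebra_simps)
  show "completely_positive (conjugation U)"
    by (simp add: completely_positive_def block_psd_conjugation)
  have "trace (U ** A ** dagger U) = trace A" for A
  proof -
    have "trace (U ** A ** dagger U) = trace (dagger U ** (U ** A))"
      by (rule qop_trace_mult_commute)
    also have "\<dots> = trace A"
      using assms by (simp add: matrix_mul_assoc unitary_def)
    finally show ?thesis .
  qed
  then show "trace_preserving (conjugation U)"
    by (simp add: trace_preserving_def)
qed

lemma channel_compose: "channel E \<Longrightarrow> channel F \<Longrightarrow> channel (E o\<^sub>L F)"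
  by (auto simp: channel_def cscale_linear_iff completely_positive_def trace_preserving_def)

lemma channel_id: "channel id_blinfun"
  by (simp add: channel_def cscale_linear_iff completely_positive_def trace_preserving_def)

lemma channel_cscale: "channel E \<Longrightarrow> blinfun_apply E (cscale c A) = cscale c (blinfun_apply E A)"
  by (simp add: channel_def cscale_linear_iff)

lemma channel_trace: "channel E \<Longrightarrow> trace (blinfun_apply E A) = trace A"
  by (simp add: channel_def trace_preserving_def)

text \<open>Complete positivity is applied to a single block: \<open>K ** dagger K\<close> is a Gram
  matrix, and hermiticity is part of \<open>psd\<close>.\<close>

lemma hermitian_channel_gram:
  assumes "channel E"
  shows "hermitian (blinfun_apply E (K ** dagger K))"
proof -
  have eq: "(\<lambda>(i, a) (j, b). (K ** dagger K) $ a $ b) =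
      (\<lambda>p q :: nat \<times> 2. \<Sum>c\<in>UNIV. (K $ snd p $ c) * cnj (K $ snd q $ c))"
    by (auto simp: fun_eq_iff sum_2 qop_mult_component)
  have "block_psd 1 (\<lambda>_ _. K ** dagger K)"
    unfolding block_psd_def eq
    using psd_gram[of "{..<1} \<times> UNIV" "\<lambda>p :: nat \<times> 2. \<lambda>c. K $ snd p $ c" UNIV] .
  then have "block_psd 1 (\<lambda>_ _. blinfun_apply E (K ** dagger K))"
    using assms by (simp add: channel_def completely_positive_def)
  then show ?thesis
    unfolding block_psd_iff hermitian_def vec_eq_iff dagger_component by (metis zero_less_one)
qed

lemma hermitian_add: "hermitian A \<Longrightarrow> hermitian B \<Longrightarrow> hermitian (A + B)"
  by (simp add: hermitian_def qop_eq_iff)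

lemma hermitian_scaleR: "hermitian A \<Longrightarrow> hermitian (r *\<^sub>R A)"
  by (simp add: hermitian_def qop_eq_iff)

text \<open>Each Pauli matrix is a difference of positive matrices, since \<^prop>\<open>\<sigma> ** \<sigma> = mat 1\<close> gives
  \<open>\<sigma> = (1 + \<sigma>)\<^sup>2 / 2 - 1\<close>.\<close>
lemma hermitian_channel_pauli:
  assumes "channel E"
  shows "hermitian (blinfun_apply E (pauli k))"
proof -
  define K where "K = mat 1 + pauli k"
  have "pauli k = (1/2) *\<^sub>R (K ** dagger K) + (-1) *\<^sub>R (mat 1 ** dagger (mat 1))"
    by (simp add: K_def pauli_def qop_simps complex_eq_iff)
  then have "blinfun_apply E (pauli k) = (1/2) *\<^sub>R blinfun_apply E (K ** dagger K)
      + (-1) *\<^sub>R blinfun_apply E (mat 1 ** dagger (mat 1))"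
    by (metis blinfun.add_right blinfun.scaleR_right)
  then show ?thesis
    by (simp only: hermitian_add hermitian_scaleR hermitian_channel_gram[OF assms])
qed

text \<open>The image is hermitian because the Pauli matrices have hermitian images, and traceless
  by trace preservation, so no multiple of \<open>mat 1\<close> appears in it.\<close>

lemma channel_bloch_op:
  assumes "channel E"
  shows "blinfun_apply E (bloch_op x) = bloch_op (bloch_matrix E *v x)"
proof -
  have "hermitian (blinfun_apply E (bloch_op x))"
    unfolding bloch_op_def blinfun.add_right blinfun.scaleR_right
    by (intro hermitian_add hermitian_scaleR hermitian_channel_pauli assms)
  then show ?thesis
    unfolding bloch_matrix_mult
    by (rule bloch_op_bloch_vec[symmetric]) (simp add: channel_trace[OF assms])
qed

text \<open>\<open>F\<close> sends Bloch operators to Bloch operators, so reading off Bloch vectors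
  between the two maps loses nothing and translations never mix in.\<close>

lemma bloch_matrix_compose:
  assumes "channel F"
  shows "bloch_matrix (E o\<^sub>L F) = bloch_matrix E ** bloch_matrix F"
  unfolding matrix_eq
proof
  fix x
  have "bloch_matrix (E o\<^sub>L F) *v x = bloch_vec (blinfun_apply E (blinfun_apply F (bloch_op x)))"
    by (simp add: bloch_matrix_mult)
  also have "\<dots> = bloch_matrix E *v (bloch_matrix F *v x)"
    unfolding channel_bloch_op[OF assms] bloch_matrix_mult[of E, symmetric] ..
  finally show "bloch_matrix (E o\<^sub>L F) *v x = (bloch_matrix E ** bloch_matrix F) *v x"
    by (simp add: matrix_vector_mul_assoc)
qed

lemma bloch_matrix_id [simp]: "bloch_matrix id_blinfun = mat 1"
  by (simp add: matrix_eq bloch_matrix_mult)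

lemma bloch_matrix_component:
  "bloch_matrix E $ i $ j = bloch_vec (blinfun_apply E (bloch_op (axis j 1))) $ i"
  unfolding bloch_matrix_mult[symmetric] by (simp add: matrix_vector_mul_component inner_axis)

text \<open>This is \<open>A = B + \<i> C\<close> with hermitian \<open>B\<close> and
  \<open>C\<close>, where \<open>C\<close> is the hermitian part of \<open>-\<i> A\<close>; the
  trace terms are collected in the first summand.\<close>

lemma qop_bloch_decomposition:
  "A = cscale (trace A / 2) (mat 1) + bloch_op (bloch_vec A)
     + cscale \<i> (bloch_op (bloch_vec (cscale (-\<i>) A)))"
  by (simp add: qop_simps bloch_op_component bloch_vec_component complex_eq_iff field_simps)

text \<open>Complex linearity extends the action from Bloch operators to all operators, so the Bloch
  matrix and the image of \<open>mat 1\<close> determine the channel.\<close>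

lemma channel_apply:
  assumes "channel E"
  shows "blinfun_apply E A = cscale (trace A / 2) (blinfun_apply E (mat 1))
     + bloch_op (bloch_matrix E *v bloch_vec A)
     + cscale \<i> (bloch_op (bloch_matrix E *v bloch_vec (cscale (-\<i>) A)))"
proof -
  have "blinfun_apply E A = blinfun_apply E (cscale (trace A / 2) (mat 1) + bloch_op (bloch_vec A)
     + cscale \<i> (bloch_op (bloch_vec (cscale (-\<i>) A))))"
    by (rule arg_cong[OF qop_bloch_decomposition])
  then show ?thesis
    by (simp only: blinfun.add_right channel_cscale[OF assms] channel_bloch_op[OF assms])
qed

lemma unital_channel_eqI:
  assumes "channel E" "unital E" "channel F" "unital F" "bloch_matrix E = bloch_matrix F"
  shows "E = F"
proof (rule blinfun_eqI)
  show "blinfun_apply E A = blinfun_apply F A" for A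
    using assms by (simp add: channel_apply[of E A] channel_apply[of F A] unital_def)
qed

section \<open>Bloch matrices of channels and unitary conjugations\<close>

lemma matrix_vector_mult_3: "(M *v x) $ i = M $ i $ 1 * x $ 1 + M $ i $ 2 * x $ 2 + M $ i $ 3 * x $ 3"
  for M :: "real ^ 3 ^ 3"
  by (simp add: matrix_vector_mult_def sum_3)

lemma matrix_mult_3: "(M ** N) $ i $ j = M $ i $ 1 * N $ 1 $ j + M $ i $ 2 * N $ 2 $ j + M $ i $ 3 * N $ 3 $ j"
  for M N :: "real ^ 3 ^ 3"
  by (simp add: matrix_matrix_mult_def sum_3)

text \<open>As a 2-by-2 array of blocks these form the unnormalised projector onto the maximally
  entangled state; applying a channel to each block gives its Choi matrix. Block index 0 corresponds
  to matrix index 1.\<close>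

definition matrix_unit :: "nat \<Rightarrow> nat \<Rightarrow> qop" where
  "matrix_unit i j = (\<chi> a b. if (a = 1 \<longleftrightarrow> i = 0) \<and> (b = 1 \<longleftrightarrow> j = 0) then 1 else 0)"

lemma block_psd_matrix_unit: "block_psd 2 matrix_unit"
  unfolding block_psd_iff
proof (intro conjI allI impI)
  fix v w :: "nat \<Rightarrow> complex"
  have "block_form 2 matrix_unit v w = complex_of_real ((cmod (v 0 + w 1))\<^sup>2)"
    unfolding complex_norm_square by (simp add: block_form_def matrix_unit_def numeral_2_eq_2 algebra_simps)
  then show "0 \<le> Re (block_form 2 matrix_unit v w)"
    by simp
qed (auto simp: matrix_unit_def)

text \<open>The four numbers are, up to a factor, the expectation values of the Choi matrix in the Bell
  states \<open>(\<sigma>\<^sub>k \<otimes> 1) \<Omega>\<close>; the translation part of the channel drops out of them.\<close>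
lemma channel_bloch_matrix_diagonal:
  assumes "channel E"
  defines "M \<equiv> bloch_matrix E"
  shows "0 \<le> 1 + M $ 1 $ 1 + M $ 2 $ 2 + M $ 3 $ 3"
    "0 \<le> 1 + M $ 1 $ 1 - M $ 2 $ 2 - M $ 3 $ 3"
    "0 \<le> 1 - M $ 1 $ 1 + M $ 2 $ 2 - M $ 3 $ 3"
    "0 \<le> 1 - M $ 1 $ 1 - M $ 2 $ 2 + M $ 3 $ 3"
proof -
  define T where "T = blinfun_apply E (mat 1)"
  have "trace T = 2"
    unfolding T_def channel_trace[OF assms(1)] by (simp add: trace_qop mat_qop_component)
  \<comment> \<open>The diagonal entries of \<open>T\<close> enter every Bell expectation value with
    equal weight, so this substitution leaves only the trace.\<close>
  then have T: "T $ 2 $ 2 = 2 - T $ 1 $ 1"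
    by (simp add: trace_qop algebra_simps)
  define X where "X i j = blinfun_apply E (matrix_unit i j)" for i j
  have "block_psd 2 X"
    using assms(1) block_psd_matrix_unit unfolding X_def
    by (simp add: channel_def completely_positive_def)
  then have nonneg: "0 \<le> Re (block_form 2 X v w)" for v w
    by (simp add: block_psd_iff)
  have X: "X i j $ a $ b = trace (matrix_unit i j) / 2 * T $ a $ b
      + bloch_op (M *v bloch_vec (matrix_unit i j)) $ a $ b
      + \<i> * bloch_op (M *v bloch_vec (cscale (-\<i>) (matrix_unit i j))) $ a $ b" for i j a b
    unfolding X_def T_def M_def by (subst channel_apply[OF assms(1)]) simp
  note form = block_form_def X T numeral_2_eq_2 matrix_unit_def trace_qop
    bloch_op_component matrix_vector_mult_3 bloch_vec_component
  show "0 \<le> 1 + M $ 1 $ 1 + M $ 2 $ 2 + M $ 3 $ 3"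
    using nonneg[of "\<lambda>i. if i = 0 then 1 else 0" "\<lambda>i. if i = 0 then 0 else 1"]
    by (simp add: form field_simps)
  show "0 \<le> 1 + M $ 1 $ 1 - M $ 2 $ 2 - M $ 3 $ 3"
    using nonneg[of "\<lambda>i. if i = 0 then 0 else 1" "\<lambda>i. if i = 0 then 1 else 0"]
    by (simp add: form field_simps)
  show "0 \<le> 1 - M $ 1 $ 1 + M $ 2 $ 2 - M $ 3 $ 3"
    using nonneg[of "\<lambda>i. if i = 0 then 0 else -\<i>" "\<lambda>i. if i = 0 then \<i> else 0"]
    by (simp add: form field_simps)
  show "0 \<le> 1 - M $ 1 $ 1 - M $ 2 $ 2 + M $ 3 $ 3"
    using nonneg[of "\<lambda>i. if i = 0 then 1 else 0" "\<lambda>i. if i = 0 then 0 else -1"]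
    by (simp add: form field_simps)
qed

section \<open>Unitary conjugations as rotations of Bloch space\<close>

abbreviation rot :: "qop \<Rightarrow> real ^ 3 ^ 3" where
  "rot U \<equiv> bloch_matrix (conjugation U)"

lemma bloch_op_rot:
  assumes "unitary U"
  shows "bloch_op (rot U *v x) = U ** bloch_op x ** dagger U"
  using channel_bloch_op[OF channel_conjugation[OF assms], of x] by simp

lemma trace_conjugation: "unitary U \<Longrightarrow> trace (U ** A ** dagger U) = trace A"
  using channel_trace[OF channel_conjugation, of U A] by simp

lemma conjugation_mult:
  assumes "unitary U"
  shows "(U ** A ** dagger U) ** (U ** B ** dagger U) = U ** (A ** B) ** dagger U"
proof -
  have "(U ** A ** dagger U) ** (U ** B ** dagger U) = U ** A ** (dagger U ** U) ** (B ** dagger U)"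
    by (simp only: matrix_mul_assoc)
  also have "\<dots> = U ** (A ** B) ** dagger U"
    using assms by (simp add: unitary_def matrix_mul_assoc)
  finally show ?thesis .
qed

lemma trace_bloch_op_square: "trace (bloch_op x ** bloch_op x) = complex_of_real (2 * (norm x)\<^sup>2)"
  unfolding norm_vec3
  by (simp add: trace_qop qop_mult_component bloch_op_component complex_eq_iff power2_eq_square)

text \<open>The squared norm is half the trace of the squared Bloch operator, which conjugation
  preserves.\<close>

lemma norm_rot:
  assumes "unitary U"
  shows "norm (rot U *v x) = norm x"
proof -
  have "trace (bloch_op (rot U *v x) ** bloch_op (rot U *v x)) = trace (bloch_op x ** bloch_op x)"
    by (simp add: bloch_op_rot conjugation_mult trace_conjugation assms)
  then have "(norm (rot U *v x))\<^sup>2 = (norm x)\<^sup>2"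
    unfolding trace_bloch_op_square of_real_eq_iff by simp
  then show ?thesis
    by simp
qed

text \<open>A triple product of Bloch operators has trace \<open>2 \<i>\<close> times the triple
  product of the vectors. Invariance of the trace then gives determinant 1 for \<open>rot U\<close>,
  with no connectedness argument.\<close>

lemma det_eq_trace_bloch_op:
  "trace (bloch_op (M *v axis 1 1) ** bloch_op (M *v axis 2 1) ** bloch_op (M *v axis 3 1)) =
     Complex 0 (2 * det M)"
  by (simp add: trace_qop qop_mult_component bloch_op_component complex_eq_iff det_3
      matrix_vector_mult_3 axis_def algebra_simps)

lemma det_rot:
  assumes "unitary U"
  shows "det (rot U) = 1"
proof -
  have "Complex 0 (2 * det (rot U)) = trace (bloch_op (axis 1 1) ** bloch_op (axis 2 1) ** bloch_op (axis 3 1))"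
    unfolding det_eq_trace_bloch_op[symmetric]
    by (simp add: bloch_op_rot conjugation_mult trace_conjugation assms)
  also have "\<dots> = Complex 0 (2 * det (mat 1 :: real ^ 3 ^ 3))"
    unfolding det_eq_trace_bloch_op[symmetric] by simp
  finally show ?thesis
    by simp
qed

lemma rot_mult: "unitary V \<Longrightarrow> rot (U ** V) = rot U ** rot V"
  by (simp add: conjugation_compose[symmetric] bloch_matrix_compose channel_conjugation)

lemma rot_dagger:
  assumes "unitary U"
  shows "rot U ** rot (dagger U) = mat 1" "rot (dagger U) ** rot U = mat 1"
  using assms rot_mult[of "dagger U" U] rot_mult[of U "dagger U"] unitary_dagger[of U]
  by (simp_all add: unitary_def)

text \<open>The defining equations are closed, and the squared Frobenius norm of \<open>U\<close> is
  the trace of \<open>U ** dagger U\<close>, namely 2. Compactness provides the maximiser in the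
  singular value decomposition.\<close>

lemma compact_unitary: "compact {U. unitary U}"
proof -
  have "closed {U :: qop. U ** dagger U = mat 1}" "closed {U :: qop. dagger U ** U = mat 1}"
    unfolding matrix_matrix_mult_def dagger_def map_matrix_def transpose_def
    by (intro closed_Collect_eq continuous_intros)+
  then have "closed {U. unitary U}"
    unfolding unitary_def by (rule closed_Collect_conj)
  moreover have "bounded {U. unitary U}"
    unfolding bounded_iff
  proof (intro exI[of _ "sqrt 2"] ballI)
    fix U assume "U \<in> {U. unitary U}"
    then have "trace (U ** dagger U) = trace (mat 1 :: qop)"
      by (simp add: unitary_def)
    then have "complex_of_real ((norm U)\<^sup>2) = 2"
      unfolding norm_qop of_real_add complex_norm_square
      by (simp add: trace_qop qop_mult_component mat_qop_component add.assoc)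
    then have "(norm U)\<^sup>2 = 2"
      by (metis of_real_eq_iff of_real_numeral)
    then show "norm U \<le> sqrt 2"
      by (simp add: real_le_rsqrt)
  qed
  ultimately show ?thesis
    by (simp add: compact_eq_bounded_closed)
qed

lemma bounded_linear_bloch_vec: "bounded_linear bloch_vec"
  using linear_bloch_vec by (simp add: linear_conv_bounded_linear)

lemma continuous_on_rot: "continuous_on S (\<lambda>U. rot U)"
proof -
  have rot: "rot U = (\<chi> i j. bloch_vec (U ** bloch_op (axis j 1) ** dagger U) $ i)" for U
    by (simp add: vec_eq_iff bloch_matrix_component)
  show ?thesis
    unfolding rot matrix_matrix_mult_def dagger_def map_matrix_def transpose_def
    by (intro continuous_intros bounded_linear.continuous_on[OF bounded_linear_bloch_vec])
qed

section \<open>Singular value decomposition by unitary conjugations\<close>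

text \<open>This is \<open>exp(i\<theta>\<sigma>\<^sub>k)\<close> for \<open>a = cos \<theta>\<close>, \<open>b = sin \<theta>\<close>.\<close>
definition axis_unitary :: "3 \<Rightarrow> real \<Rightarrow> real \<Rightarrow> qop" where
  "axis_unitary k a b = a *\<^sub>R mat 1 + b *\<^sub>R cscale \<i> (bloch_op (axis k 1))"

lemma axis_unitary_component:
  "axis_unitary 1 a b $ 1 $ 1 = a" "axis_unitary 1 a b $ 1 $ 2 = \<i> * b"
  "axis_unitary 1 a b $ 2 $ 1 = \<i> * b" "axis_unitary 1 a b $ 2 $ 2 = a"
  "axis_unitary 2 a b $ 1 $ 1 = a" "axis_unitary 2 a b $ 1 $ 2 = b"
  "axis_unitary 2 a b $ 2 $ 1 = - b" "axis_unitary 2 a b $ 2 $ 2 = a"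
  "axis_unitary 3 a b $ 1 $ 1 = Complex a b" "axis_unitary 3 a b $ 1 $ 2 = 0"
  "axis_unitary 3 a b $ 2 $ 1 = 0" "axis_unitary 3 a b $ 2 $ 2 = Complex a (- b)"
  by (simp_all add: axis_unitary_def bloch_op_component axis_def mat_qop_component complex_eq_iff)

lemma unitary_axis_unitary:
  assumes "a\<^sup>2 + b\<^sup>2 = 1"
  shows "unitary (axis_unitary 1 a b)" "unitary (axis_unitary 2 a b)" "unitary (axis_unitary 3 a b)"
  using assms
  by (simp_all add: unitary_def qop_eq_iff qop_mult_component mat_qop_component axis_unitary_component
      complex_eq_iff power2_eq_square algebra_simps)

text \<open>The angle doubles: for \<open>a = cos \<theta>\<close> and
  \<open>b = sin \<theta>\<close>, the entries are the cosine and sine of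
  \<open>2 \<theta>\<close>.\<close>

lemma rot_axis_unitary:
  assumes "a\<^sup>2 + b\<^sup>2 = 1"
  defines "c \<equiv> a\<^sup>2 - b\<^sup>2" and "s \<equiv> 2 * a * b"
  shows "rot (axis_unitary 1 a b) = vector [vector [1, 0, 0], vector [0, c, s], vector [0, -s, c]]"
    "rot (axis_unitary 2 a b) = vector [vector [c, 0, -s], vector [0, 1, 0], vector [s, 0, c]]"
    "rot (axis_unitary 3 a b) = vector [vector [c, s, 0], vector [-s, c, 0], vector [0, 0, 1]]"
  using assms(1) unfolding c_def s_def
  by (simp_all add: vec_eq_iff forall_3 bloch_matrix_component bloch_vec_component
      qop_mult_component bloch_op_component axis_unitary_component axis_def
      power2_eq_square field_simps)

text \<open>By double angles, the left side is the inner product of \<open>(p, q)\<close> with an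
  arbitrary unit vector. Its maximum is the length of \<open>(p, q)\<close>, which is at most
  \<open>p\<close> only if \<open>q = 0\<close> and \<open>0 \<le> p\<close>.\<close>

lemma rotation_maximum:
  fixes p q :: real
  assumes "\<And>a b. a\<^sup>2 + b\<^sup>2 = 1 \<Longrightarrow> (a\<^sup>2 - b\<^sup>2) * p + 2 * a * b * q \<le> p"
  shows "q = 0" "0 \<le> p"
proof -
  show "0 \<le> p"
    using assms[of 0 1] by simp
  show "q = 0"
  proof (rule ccontr)
    assume "q \<noteq> 0"
    \<comment> \<open>The maximising half angle has direction
      \<open>(p + sqrt (p\<^sup>2 + q\<^sup>2), q)\<close>; with \<open>\<bar>q\<bar>\<close> in
      place of the root, the value still exceeds \<open>p\<close>.\<close>
    define n where "n = sqrt ((p + \<bar>q\<bar>)\<^sup>2 + q\<^sup>2)"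
    have n2: "n\<^sup>2 = (p + \<bar>q\<bar>)\<^sup>2 + q\<^sup>2"
      by (simp add: n_def)
    then have "0 < n\<^sup>2"
      using \<open>q \<noteq> 0\<close> by (simp add: add_nonneg_pos)
    define a b where "a = (p + \<bar>q\<bar>) / n" and "b = q / n"
    have "a\<^sup>2 + b\<^sup>2 = ((p + \<bar>q\<bar>)\<^sup>2 + q\<^sup>2) / n\<^sup>2"
      unfolding add_divide_distrib[of "(p + \<bar>q\<bar>)\<^sup>2"] a_def b_def power_divide ..
    then have ab: "a\<^sup>2 + b\<^sup>2 = 1"
      using \<open>0 < n\<^sup>2\<close> unfolding n2[symmetric] by simp
    then have "a\<^sup>2 - b\<^sup>2 = 1 - 2 * b\<^sup>2"
      by simp
    then have "(1 - 2 * b\<^sup>2) * p + 2 * a * b * q \<le> p"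
      using assms[OF ab] by (simp only:)
    then have "a * b * q - b\<^sup>2 * p \<le> 0"
      by (simp add: algebra_simps)
    moreover have "a * b * q - b\<^sup>2 * p = q\<^sup>2 * \<bar>q\<bar> / n\<^sup>2"
    proof -
      have "a * b * q - b\<^sup>2 * p = ((p + \<bar>q\<bar>) * q * q - q\<^sup>2 * p) / n\<^sup>2"
        unfolding a_def b_def by (simp add: power2_eq_square diff_divide_distrib)
      then show ?thesis
        by (simp add: power2_eq_square algebra_simps)
    qed
    moreover have "0 < q\<^sup>2 * \<bar>q\<bar> / n\<^sup>2"
      using \<open>q \<noteq> 0\<close> \<open>0 < n\<^sup>2\<close> by simp
    ultimately show False
      by simp
  qed
qed

text \<open>The pair \<open>(U, V)\<close> maximises \<open>N\<^sub>1\<^sub>1 + 2 N\<^sub>2\<^sub>2 + 3 N\<^sub>3\<^sub>3\<close> for \<open>N = rot U ** M ** rot V\<close>; the weights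
  are distinct, so that stationarity under the one-parameter subgroups on both sides kills
  all off-diagonal entries.\<close>
lemma rot_singular_value_decomposition:
  "\<exists>U V. unitary U \<and> unitary V \<and>
     (\<forall>i j. i \<noteq> j \<longrightarrow> (rot U ** M ** rot V) $ i $ j = 0) \<and>
     (0 \<le> det M \<longrightarrow> (\<forall>i. 0 \<le> (rot U ** M ** rot V) $ i $ i))"
proof -
  define w where "w N = N $ 1 $ 1 + 2 * N $ 2 $ 2 + 3 * N $ 3 $ 3" for N :: "real ^ 3 ^ 3"
  let ?S = "{U. unitary U} \<times> {U. unitary U}"
  have S: "compact ?S"
    by (intro compact_Times compact_unitary)
  have ne: "?S \<noteq> {}"
    by (auto simp: unitary_def intro: exI[of _ "mat 1"])
  have cont: "continuous_on ?S (\<lambda>p. w (rot (fst p) ** M ** rot (snd p)))"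
    unfolding w_def matrix_mult_3
    by (intro continuous_intros continuous_on_compose2[OF continuous_on_rot[of UNIV]]) auto
  from continuous_attains_sup[OF S ne cont] obtain U V where U: "unitary U" and V: "unitary V"
    and max: "\<And>U' V'. unitary U' \<Longrightarrow> unitary V' \<Longrightarrow>
      w (rot U' ** M ** rot V') \<le> w (rot U ** M ** rot V)"
    by auto
  define N where "N = rot U ** M ** rot V"
  \<comment> \<open>Since \<open>rot\<close> is multiplicative, rotating \<open>N\<close> on one
    side only changes one member of the maximising pair.\<close>
  have left: "w (rot Z ** N) \<le> w N" if "unitary Z" for Z
    using max[OF unitary_mult[OF that U] V] that U
    by (simp add: N_def rot_mult unitary_mult matrix_mul_assoc)
  have right: "w (N ** rot Z) \<le> w N" if "unitary Z" for Z
    using max[OF U unitary_mult[OF V that]] that V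
    by (simp add: N_def rot_mult unitary_mult matrix_mul_assoc)
  have L1: "(a\<^sup>2 - b\<^sup>2) * (2 * N $ 2 $ 2 + 3 * N $ 3 $ 3) + 2 * a * b * (2 * N $ 3 $ 2 - 3 * N $ 2 $ 3) \<le> 2 * N $ 2 $ 2 + 3 * N $ 3 $ 3"
    and R1: "(a\<^sup>2 - b\<^sup>2) * (2 * N $ 2 $ 2 + 3 * N $ 3 $ 3) + 2 * a * b * (3 * N $ 3 $ 2 - 2 * N $ 2 $ 3) \<le> 2 * N $ 2 $ 2 + 3 * N $ 3 $ 3"
    if "a\<^sup>2 + b\<^sup>2 = 1" for a b
    using left[OF unitary_axis_unitary(1)[OF that]] right[OF unitary_axis_unitary(1)[OF that]]
    by (simp_all add: rot_axis_unitary[OF that] w_def matrix_mult_3 algebra_simps)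
  \<comment> \<open>The two stationarity conditions
    \<open>2 N\<^sub>3\<^sub>2 = 3 N\<^sub>2\<^sub>3\<close> and
    \<open>3 N\<^sub>3\<^sub>2 = 2 N\<^sub>2\<^sub>3\<close> have only the zero solution.\<close>
  have N23: "N $ 2 $ 3 = 0" "N $ 3 $ 2 = 0"
    using rotation_maximum(1)[OF L1] rotation_maximum(1)[OF R1] by simp_all
  have L2: "(a\<^sup>2 - b\<^sup>2) * (N $ 1 $ 1 + 3 * N $ 3 $ 3) + 2 * a * b * (3 * N $ 1 $ 3 - N $ 3 $ 1) \<le> N $ 1 $ 1 + 3 * N $ 3 $ 3"
    and R2: "(a\<^sup>2 - b\<^sup>2) * (N $ 1 $ 1 + 3 * N $ 3 $ 3) + 2 * a * b * (N $ 1 $ 3 - 3 * N $ 3 $ 1) \<le> N $ 1 $ 1 + 3 * N $ 3 $ 3"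
    if "a\<^sup>2 + b\<^sup>2 = 1" for a b
    using left[OF unitary_axis_unitary(2)[OF that]] right[OF unitary_axis_unitary(2)[OF that]]
    by (simp_all add: rot_axis_unitary[OF that] w_def matrix_mult_3 algebra_simps)
  have N13: "N $ 1 $ 3 = 0" "N $ 3 $ 1 = 0"
    using rotation_maximum(1)[OF L2] rotation_maximum(1)[OF R2] by simp_all
  have L3: "(a\<^sup>2 - b\<^sup>2) * (N $ 1 $ 1 + 2 * N $ 2 $ 2) + 2 * a * b * (N $ 2 $ 1 - 2 * N $ 1 $ 2) \<le> N $ 1 $ 1 + 2 * N $ 2 $ 2"
    and R3: "(a\<^sup>2 - b\<^sup>2) * (N $ 1 $ 1 + 2 * N $ 2 $ 2) + 2 * a * b * (2 * N $ 2 $ 1 - N $ 1 $ 2) \<le> N $ 1 $ 1 + 2 * N $ 2 $ 2"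
    if "a\<^sup>2 + b\<^sup>2 = 1" for a b
    using left[OF unitary_axis_unitary(3)[OF that]] right[OF unitary_axis_unitary(3)[OF that]]
    by (simp_all add: rot_axis_unitary[OF that] w_def matrix_mult_3 algebra_simps)
  have N12: "N $ 1 $ 2 = 0" "N $ 2 $ 1 = 0"
    using rotation_maximum(1)[OF L3] rotation_maximum(1)[OF R3] by simp_all
  have det: "det M = N $ 1 $ 1 * N $ 2 $ 2 * N $ 3 $ 3"
  proof -
    have "det N = det M"
      by (simp add: N_def det_mul det_rot U V)
    then show ?thesis
      by (simp add: det_3 N12 N13 N23)
  qed
  have "0 \<le> N $ i $ i" if "0 \<le> det M" for i
  proof -
    \<comment> \<open>The pairwise weighted sums of diagonal entries are non-negative, so a negative
      entry would force the other two to be positive and the determinant to be negative.\<close>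
    have "0 \<le> N $ 1 $ 1 \<and> 0 \<le> N $ 2 $ 2 \<and> 0 \<le> N $ 3 $ 3"
      using that rotation_maximum(2)[OF L1] rotation_maximum(2)[OF L2] rotation_maximum(2)[OF L3] unfolding det
      by (smt (verit) mult_pos_pos mult_neg_pos mult_pos_neg)
    then show ?thesis
      using exhaust_3[of i] by auto
  qed
  moreover have "N $ i $ j = 0" if "i \<noteq> j" for i j
    using that exhaust_3[of i] exhaust_3[of j] N12 N13 N23 by auto
  ultimately show ?thesis
    using U V unfolding N_def by blast
qed

section \<open>Singular values of infinitesimal divisible channels\<close>

text \<open>For singular values \<open>s\<^sub>1, s\<^sub>2, s\<^sub>3\<close> of \<open>M\<close> the second condition reads
  \<open>(s\<^sub>1 s\<^sub>2 s\<^sub>3) powr (1 + \<eta>) \<le> s\<^sub>k\<^sup>2\<close>; for \<open>\<eta> = 0\<close> this is \<open>s\<^sub>i s\<^sub>j \<le> s\<^sub>k\<close>. In this form it is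
  multiplicative.\<close>
definition det_dominated :: "real \<Rightarrow> real ^ 3 ^ 3 \<Rightarrow> bool" where
  "det_dominated \<eta> M \<longleftrightarrow>
     0 < det M \<and> (\<forall>x. det M powr (1 + \<eta>) * (norm x)\<^sup>2 \<le> (norm (M *v x))\<^sup>2)"

lemma det_dominated_mult:
  assumes M: "det_dominated \<eta> M" and N: "det_dominated \<eta> N"
  shows "det_dominated \<eta> (M ** N)"
  unfolding det_dominated_def
proof (intro conjI allI)
  show "0 < det (M ** N)"
    using M N by (simp add: det_dominated_def det_mul)
  fix x :: "real ^ 3"
  have "det (M ** N) powr (1 + \<eta>) * (norm x)\<^sup>2 = det M powr (1 + \<eta>) * (det N powr (1 + \<eta>) * (norm x)\<^sup>2)"
    using M N by (simp add: det_dominated_def det_mul powr_mult)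
  also have "\<dots> \<le> det M powr (1 + \<eta>) * (norm (N *v x))\<^sup>2"
    using N by (intro mult_left_mono) (simp_all add: det_dominated_def)
  also have "\<dots> \<le> (norm (M *v (N *v x)))\<^sup>2"
    using M unfolding det_dominated_def by blast
  finally show "det (M ** N) powr (1 + \<eta>) * (norm x)\<^sup>2 \<le> (norm ((M ** N) *v x))\<^sup>2"
    by (simp add: matrix_vector_mul_assoc)
qed

lemma det_dominated_mat_1: "det_dominated \<eta> (mat 1)"
  by (simp add: det_dominated_def)

lemma det_dominated_rot: "unitary U \<Longrightarrow> det_dominated \<eta> (rot U)"
  by (simp add: det_dominated_def det_rot norm_rot)

text \<open>Combine \<open>ln d \<le> d - 1\<close> with \<open>1 + x \<le> exp x\<close> for
  \<open>x = - \<eta> ln d\<close>.\<close>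

lemma powr_mult_le_1:
  fixes d \<eta> :: real
  assumes "0 < d" "0 \<le> \<eta>"
  shows "d powr \<eta> * (1 + \<eta> * (1 - d)) \<le> 1"
proof -
  have "1 + \<eta> * (1 - d) \<le> 1 + \<eta> * (- ln d)"
    using ln_le_minus_one[OF assms(1)] assms(2) by (intro add_left_mono mult_left_mono) auto
  also have "\<dots> \<le> exp (\<eta> * (- ln d))"
    by (rule exp_ge_add_one_self)
  finally have "d powr \<eta> * (1 + \<eta> * (1 - d)) \<le> d powr \<eta> * exp (\<eta> * (- ln d))"
    by (intro mult_left_mono) auto
  also have "\<dots> = 1"
    using assms(1) by (simp add: powr_def flip: exp_add)
  finally show ?thesis .
qed

text \<open>The condition \<open>s + t \<le> 1 + u\<close> gives \<open>s t - u \<le> (1 - s) (1 - t) \<le> \<epsilon> (1 - s t u)\<close>.\<close>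
lemma near_one_dominated:
  fixes s t u \<epsilon> \<eta> :: real
  assumes "s \<le> 1" "t \<le> 1" "u \<le> 1" "s + t \<le> 1 + u"
    and "1 - \<epsilon> \<le> s" "1 - \<epsilon> \<le> u" "0 < s" "0 < t" "0 < u" "0 \<le> \<eta>" "\<epsilon> * (1 + \<eta>) \<le> \<eta>"
  shows "(s * t * u) powr (1 + \<eta>) \<le> u\<^sup>2"
proof -
  define d where "d = s * t * u"
  have d0: "0 < d"
    using assms by (simp add: d_def)
  have "s * u \<le> 1"
    using assms by (simp add: mult_le_one)
  then have dt: "d \<le> t"
    using assms mult_right_mono[of "s * u" 1 t] by (simp add: d_def mult_ac)
  have "s * t \<le> u + (1 - s) * (1 - t)"
    using assms by (simp add: algebra_simps)
  \<comment> \<open>Here \<open>1 - s \<le> \<epsilon>\<close>, and \<open>1 - t \<le> 1 - d\<close>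
    because \<open>d \<le> t\<close>.\<close>
  also have "(1 - s) * (1 - t) \<le> \<epsilon> * (1 - d)"
    using assms dt by (intro mult_mono) auto
  \<comment> \<open>The error is made proportional to \<open>u\<close>, so that it can be absorbed
    as a relative factor.\<close>
  also have "\<epsilon> * (1 - d) \<le> (u * \<eta>) * (1 - d)"
  proof (rule mult_right_mono)
    have "\<epsilon> \<le> (1 - \<epsilon>) * \<eta>"
      using assms by (simp add: algebra_simps)
    also have "\<dots> \<le> u * \<eta>"
      using assms by (intro mult_right_mono)
    finally show "\<epsilon> \<le> u * \<eta>" .
  qed (use assms dt in auto)
  finally have "s * t \<le> u * (1 + \<eta> * (1 - d))"
    by (simp add: algebra_simps)
  then have "d \<le> u * (1 + \<eta> * (1 - d)) * u"
    unfolding d_def using assms by (intro mult_right_mono) auto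
  then have "d * d powr \<eta> \<le> u * (1 + \<eta> * (1 - d)) * u * d powr \<eta>"
    by (intro mult_right_mono) auto
  also have "\<dots> = u\<^sup>2 * (d powr \<eta> * (1 + \<eta> * (1 - d)))"
    by (simp add: power2_eq_square)
  also have "\<dots> \<le> u\<^sup>2 * 1"
    using powr_mult_le_1[OF d0] assms by (intro mult_left_mono) auto
  finally show ?thesis
    using d0 by (simp add: powr_add d_def)
qed

lemma continuous_on_bloch_matrix: "continuous_on S (\<lambda>T. bloch_matrix T $ i $ j)"
  unfolding bloch_matrix_component
  by (intro continuous_intros bounded_linear.continuous_on[OF bounded_linear_bloch_vec])

lemma continuous_on_det_bloch_matrix: "continuous_on S (\<lambda>T. det (bloch_matrix T))"
  unfolding det_3
  by (intro continuous_on_add continuous_on_diff continuous_on_mult continuous_on_bloch_matrix)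

text \<open>The factors \<open>sqrt 2\<close> from passing to Bloch operators and back
  cancel.\<close>

lemma norm_bloch_matrix_diff:
  "norm (bloch_matrix T *v x - x) \<le> norm (T - id_blinfun) * norm x"
proof -
  have "bloch_matrix T *v x - x = bloch_vec (blinfun_apply (T - id_blinfun) (bloch_op x))"
    using linear_diff[OF linear_bloch_vec] by (simp add: bloch_matrix_mult blinfun.diff_left)
  then have "sqrt 2 * norm (bloch_matrix T *v x - x) \<le> norm (blinfun_apply (T - id_blinfun) (bloch_op x))"
    by (simp add: norm_bloch_vec_le)
  also have "\<dots> \<le> norm (T - id_blinfun) * (sqrt 2 * norm x)"
    using norm_blinfun[of "T - id_blinfun" "bloch_op x"] by (simp add: norm_bloch_op)
  finally have "sqrt 2 * norm (bloch_matrix T *v x - x) \<le> sqrt 2 * (norm (T - id_blinfun) * norm x)"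
    by (simp only: mult_ac)
  then show ?thesis
    by simp
qed

lemma bloch_matrix_sandwich:
  assumes "channel T" "unitary V"
  shows "bloch_matrix (conjugation U o\<^sub>L T o\<^sub>L conjugation V) = rot U ** bloch_matrix T ** rot V"
  by (simp add: bloch_matrix_compose channel_conjugation assms)

text \<open>Conjugating by unitaries on both sides leaves a channel, now with diagonal Bloch matrix,
  so the Choi inequalities apply to the singular values themselves.\<close>

lemma channel_singular_value_decomposition:
  assumes T: "channel T" and det: "0 \<le> det (bloch_matrix T)"
  shows "\<exists>U V s. unitary U \<and> unitary V \<and>
    (\<forall>i j. (rot U ** bloch_matrix T ** rot V) $ i $ j = (if i = j then s i else 0)) \<and>
    (\<forall>i. 0 \<le> s i \<and> s i \<le> 1) \<and>
    s 1 + s 2 \<le> 1 + s 3 \<and> s 1 + s 3 \<le> 1 + s 2 \<and> s 2 + s 3 \<le> 1 + s 1 \<and>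
    det (bloch_matrix T) = s 1 * s 2 * s 3"
proof -
  from rot_singular_value_decomposition[of "bloch_matrix T"] obtain U V
    where U: "unitary U" and V: "unitary V"
      and offdiag: "\<forall>i j. i \<noteq> j \<longrightarrow> (rot U ** bloch_matrix T ** rot V) $ i $ j = 0"
      and diag: "\<forall>i. 0 \<le> (rot U ** bloch_matrix T ** rot V) $ i $ i"
    using det by (elim exE conjE) simp
  define N where "N = rot U ** bloch_matrix T ** rot V"
  have N: "N = bloch_matrix (conjugation U o\<^sub>L T o\<^sub>L conjugation V)"
    by (simp add: N_def bloch_matrix_sandwich T V)
  have chN: "channel (conjugation U o\<^sub>L T o\<^sub>L conjugation V)"
    by (intro channel_compose channel_conjugation T U V)
  note tetra = channel_bloch_matrix_diagonal[OF chN, folded N]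
  define s where "s i = N $ i $ i" for i
  have diagN: "\<forall>i j. (rot U ** bloch_matrix T ** rot V) $ i $ j = (if i = j then s i else 0)"
    using offdiag by (simp add: s_def N_def)
  have bounds: "\<forall>i. 0 \<le> s i \<and> s i \<le> 1"
  proof
    fix i
    \<comment> \<open>Adding the two Choi inequalities in which \<open>s i\<close> has a negative
      sign cancels the other two values.\<close>
    have "s i \<le> 1"
      using tetra exhaust_3[of i] unfolding s_def by auto
    then show "0 \<le> s i \<and> s i \<le> 1"
      using diag by (simp add: s_def N_def)
  qed
  have ineqs: "s 1 + s 2 \<le> 1 + s 3" "s 1 + s 3 \<le> 1 + s 2" "s 2 + s 3 \<le> 1 + s 1"
    using tetra unfolding s_def by simp_all
  have "det N = det (bloch_matrix T)"
    by (simp add: N_def det_mul det_rot U V)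
  moreover have "det N = s 1 * s 2 * s 3"
    using diagN unfolding det_3 N_def by simp
  ultimately have dets: "det (bloch_matrix T) = s 1 * s 2 * s 3"
    by simp
  show ?thesis
    by (intro exI[of _ U] exI[of _ V] exI[of _ s] conjI U V diagN bounds ineqs dets)
qed

lemma diagonal_mult_vector:
  fixes N :: "real ^ 3 ^ 3"
  assumes "\<And>i j. N $ i $ j = (if i = j then s i else 0)"
  shows "(N *v x) $ i = s i * x $ i"
  using exhaust_3[of i] by (auto simp: matrix_vector_mult_3 assms)

lemma det_dominated_near_id:
  assumes "0 < \<eta>"
  shows "\<exists>\<epsilon>>0. \<forall>T. channel T \<longrightarrow> norm (T - id_blinfun) < \<epsilon> \<longrightarrow> det_dominated \<eta> (bloch_matrix T)"
proof -
  have "open {T. 0 < det (bloch_matrix T)}"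
    by (intro open_Collect_less continuous_on_const continuous_on_det_bloch_matrix)
  moreover have "id_blinfun \<in> {T. 0 < det (bloch_matrix T)}"
    by simp
  ultimately obtain \<delta> where "0 < \<delta>" and \<delta>: "\<And>T. dist T id_blinfun < \<delta> \<Longrightarrow> 0 < det (bloch_matrix T)"
    unfolding open_dist by blast
  \<comment> \<open>The first bound keeps the determinant positive; the second is the smallness
    condition of \<open>near_one_dominated\<close>.\<close>
  define \<epsilon> where "\<epsilon> = min \<delta> (\<eta> / (1 + \<eta>))"
  have "0 < \<epsilon>"
    using \<open>0 < \<delta>\<close> assms by (simp add: \<epsilon>_def)
  have "\<epsilon> \<le> \<eta> / (1 + \<eta>)"
    by (simp add: \<epsilon>_def)
  then have \<epsilon>: "\<epsilon> * (1 + \<eta>) \<le> \<eta>"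
    using assms by (simp add: field_simps)
  have "det_dominated \<eta> (bloch_matrix T)" if T: "channel T" and near: "norm (T - id_blinfun) < \<epsilon>" for T
  proof -
    define M where "M = bloch_matrix T"
    have det: "0 < det M"
      using \<delta>[of T] near by (simp add: \<epsilon>_def dist_norm M_def)
    from channel_singular_value_decomposition[OF T less_imp_le] det obtain U V s
      where U: "unitary U" and V: "unitary V"
        and diag: "\<And>i j. (rot U ** M ** rot V) $ i $ j = (if i = j then s i else 0)"
        and nonneg: "\<And>i. 0 \<le> s i" and le1: "\<And>i. s i \<le> 1"
        and tetra: "s 1 + s 2 \<le> 1 + s 3" "s 1 + s 3 \<le> 1 + s 2" "s 2 + s 3 \<le> 1 + s 1"
        and dets: "det M = s 1 * s 2 * s 3"
      unfolding M_def by metis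
    define N where "N = rot U ** M ** rot V"
    have pos: "0 < s i" for i
      using det nonneg[of i] exhaust_3[of i] unfolding dets by (auto simp: less_le)
    have lower: "1 - \<epsilon> \<le> s k" for k
    proof -
      \<comment> \<open>\<open>M\<close> stretches this unit vector by exactly \<open>s k\<close>,
        yet moves it by at most \<open>\<epsilon>\<close>.\<close>
      define x where "x = rot V *v axis k 1"
      have x: "norm x = 1"
        by (simp add: x_def norm_rot V)
      have "N *v axis k 1 = s k *\<^sub>R axis k 1"
        using exhaust_3[of k]
        by (auto simp: vec_eq_iff N_def diagonal_mult_vector[OF diag] axis_def)
      then have "s k = norm (N *v axis k 1)"
        using nonneg by simp
      also have "\<dots> = norm (M *v x)"
        by (simp add: N_def x_def norm_rot U flip: matrix_vector_mul_assoc)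
      also have "norm (M *v x - x) \<le> \<epsilon>"
        using norm_bloch_matrix_diff[of T x] near by (simp add: M_def x)
      then have "1 - \<epsilon> \<le> norm (M *v x)"
        using norm_triangle_ineq2[of x "M *v x"] by (simp add: x norm_minus_commute)
      finally show ?thesis .
    qed
    have dom: "det M powr (1 + \<eta>) \<le> (s k)\<^sup>2" for k
    proof -
      have "(s 2 * s 3 * s 1) powr (1 + \<eta>) \<le> (s 1)\<^sup>2" "(s 1 * s 3 * s 2) powr (1 + \<eta>) \<le> (s 2)\<^sup>2"
        "(s 1 * s 2 * s 3) powr (1 + \<eta>) \<le> (s 3)\<^sup>2"
        using assms by (intro near_one_dominated[where \<epsilon> = \<epsilon>] le1 tetra lower pos \<epsilon>; simp)+
      then show ?thesis
        unfolding dets using exhaust_3[of k] by (auto simp: mult_ac)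
    qed
    have "det_dominated \<eta> N"
      unfolding det_dominated_def
    proof (intro conjI allI)
      have detN: "det N = det M"
        by (simp add: N_def det_mul det_rot U V)
      then show "0 < det N"
        using det by simp
      fix x :: "real ^ 3"
      have "det M powr (1 + \<eta>) * (norm x)\<^sup>2 \<le> (s 1)\<^sup>2 * (x $ 1)\<^sup>2 + (s 2)\<^sup>2 * (x $ 2)\<^sup>2 + (s 3)\<^sup>2 * (x $ 3)\<^sup>2"
        unfolding norm_vec3 distrib_left by (intro add_mono mult_right_mono dom) auto
      also have "\<dots> = (norm (N *v x))\<^sup>2"
        unfolding norm_vec3 N_def diagonal_mult_vector[OF diag] by (simp add: power_mult_distrib)
      finally show "det N powr (1 + \<eta>) * (norm x)\<^sup>2 \<le> (norm (N *v x))\<^sup>2"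
        by (simp add: detN)
    qed
    then have "det_dominated \<eta> (rot (dagger U) ** N ** rot (dagger V))"
      by (intro det_dominated_mult det_dominated_rot unitary_dagger U V)
    also have "rot (dagger U) ** N ** rot (dagger V) = M"
    proof -
      have "rot (dagger U) ** N ** rot (dagger V) =
          (rot (dagger U) ** rot U) ** M ** (rot V ** rot (dagger V))"
        unfolding N_def by (simp only: matrix_mul_assoc)
      then show ?thesis
        by (simp add: rot_dagger U V)
    qed
    finally show ?thesis
      by (simp add: M_def)
  qed
  with \<open>0 < \<epsilon>\<close> show ?thesis
    by blast
qed

text \<open>The factorisation varies with \<open>\<eta>\<close>, but the bound for the product does
  not depend on the number of factors, so \<open>\<eta>\<close> may tend to 0 for the fixed map
  \<open>T\<close>.\<close>

lemma det_dominated_L_CP: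
  assumes "T \<in> L_CP"
  shows "det_dominated 0 (bloch_matrix T)"
proof -
  have dom: "det_dominated \<eta> (bloch_matrix T)" if \<eta>: "0 < \<eta>" for \<eta>
  proof -
    obtain \<epsilon> where "0 < \<epsilon>" and \<epsilon>: "\<And>S. channel S \<Longrightarrow> norm (S - id_blinfun) < \<epsilon> \<Longrightarrow> det_dominated \<eta> (bloch_matrix S)"
      using det_dominated_near_id[OF \<eta>] by blast
    obtain Es where Es: "\<forall>S\<in>set Es. channel S \<and> norm (S - id_blinfun) < \<epsilon>"
      and T: "T = foldr (o\<^sub>L) Es id_blinfun"
      using assms \<open>0 < \<epsilon>\<close> unfolding L_CP_def by blast
    have "channel (foldr (o\<^sub>L) Es id_blinfun) \<and> det_dominated \<eta> (bloch_matrix (foldr (o\<^sub>L) Es id_blinfun))"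
      using Es
    proof (induction Es)
      case Nil
      then show ?case
        by (simp add: channel_id det_dominated_mat_1)
    next
      case (Cons S Es)
      then show ?case
        by (simp add: channel_compose bloch_matrix_compose det_dominated_mult \<epsilon>)
    qed
    then show ?thesis
      by (simp add: T)
  qed
  define d where "d = det (bloch_matrix T)"
  have d: "0 < d"
    using dom[of 1] by (simp add: det_dominated_def d_def)
  have "d powr (1 + 0) * (norm x)\<^sup>2 \<le> (norm (bloch_matrix T *v x))\<^sup>2" for x
  proof (rule tendsto_upperbound)
    show "((\<lambda>\<eta>. d powr (1 + \<eta>) * (norm x)\<^sup>2) \<longlongrightarrow> d powr (1 + 0) * (norm x)\<^sup>2) (at_right 0)"
      using d by (intro tendsto_intros) auto
    show "\<forall>\<^sub>F \<eta> in at_right 0. d powr (1 + \<eta>) * (norm x)\<^sup>2 \<le> (norm (bloch_matrix T *v x))\<^sup>2"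
      using dom by (auto simp: eventually_at_right_less det_dominated_def d_def
          intro: eventually_mono[OF eventually_at_right_less])
  qed simp
  then show ?thesis
    using d by (simp add: det_dominated_def d_def)
qed

text \<open>The vector \<open>x\<close> in the proof is the cross product of the other two rows of \<open>M\<close>, so that
  \<open>M *v x\<close> is a multiple of a basis vector.\<close>
lemma det_dominated_minors:
  assumes "det_dominated 0 M"
  shows "(M $ 1 $ 1 * M $ 2 $ 2 - M $ 1 $ 2 * M $ 2 $ 1)\<^sup>2 \<le> det M"
    "(M $ 1 $ 1 * M $ 3 $ 3 - M $ 1 $ 3 * M $ 3 $ 1)\<^sup>2 \<le> det M"
    "(M $ 2 $ 2 * M $ 3 $ 3 - M $ 2 $ 3 * M $ 3 $ 2)\<^sup>2 \<le> det M"
proof -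
  \<comment> \<open>Dividing the dominance inequality at \<open>x\<close> by the determinant bounds
    the norm of \<open>x\<close>, hence the coordinate that is the minor.\<close>
  have bound: "m\<^sup>2 \<le> det M" if "norm (M *v x) = \<bar>det M\<bar>" "m\<^sup>2 = (x $ k)\<^sup>2" for x m k
  proof -
    have d: "0 < det M" and "det M * (norm x)\<^sup>2 \<le> (det M)\<^sup>2"
      using assms that(1) by (auto simp: det_dominated_def) (metis power2_abs)
    then have "(norm x)\<^sup>2 \<le> det M"
      by (simp add: power2_eq_square)
    moreover have "(x $ k)\<^sup>2 \<le> (norm x)\<^sup>2"
      using component_le_norm_cart[of x k] by (metis abs_le_square_iff abs_norm_cancel)
    ultimately show ?thesis
      using that(2) by simp
  qed
  have axis: "norm (y :: real ^ 3) = \<bar>c\<bar>" if "y = c *\<^sub>R axis k 1" for y c k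
    using that by simp
  let ?r = "\<lambda>i j. vector [M $ i $ 2 * M $ j $ 3 - M $ i $ 3 * M $ j $ 2,
    M $ i $ 3 * M $ j $ 1 - M $ i $ 1 * M $ j $ 3, M $ i $ 1 * M $ j $ 2 - M $ i $ 2 * M $ j $ 1] :: real ^ 3"
  have "M *v ?r 1 2 = det M *\<^sub>R axis 3 1" "M *v ?r 3 1 = det M *\<^sub>R axis 2 1" "M *v ?r 2 3 = det M *\<^sub>R axis 1 1"
    by (simp_all add: vec3_eq_iff matrix_vector_mult_3 det_3 axis_def algebra_simps)
  note r = this[THEN axis]
  show "(M $ 1 $ 1 * M $ 2 $ 2 - M $ 1 $ 2 * M $ 2 $ 1)\<^sup>2 \<le> det M"
    by (rule bound[OF r(1), of _ 3]) simp
  show "(M $ 1 $ 1 * M $ 3 $ 3 - M $ 1 $ 3 * M $ 3 $ 1)\<^sup>2 \<le> det M"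
    by (rule bound[OF r(2), of _ 2]) (simp add: power2_commute mult_ac)
  show "(M $ 2 $ 2 * M $ 3 $ 3 - M $ 2 $ 3 * M $ 3 $ 2)\<^sup>2 \<le> det M"
    by (rule bound[OF r(3), of _ 1]) simp
qed

text \<open>Positivity of the determinant may be lost in the closure, but these polynomial
  inequalities define closed sets. The fixed rotations are inserted before passing to the closure,
  since they preserve dominance.\<close>

lemma minors_closure_L_CP:
  assumes "T \<in> closure L_CP" "unitary U" "unitary V"
  defines "M \<equiv> rot U ** bloch_matrix T ** rot V"
  shows "0 \<le> det M"
    "(M $ 1 $ 1 * M $ 2 $ 2 - M $ 1 $ 2 * M $ 2 $ 1)\<^sup>2 \<le> det M"
    "(M $ 1 $ 1 * M $ 3 $ 3 - M $ 1 $ 3 * M $ 3 $ 1)\<^sup>2 \<le> det M"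
    "(M $ 2 $ 2 * M $ 3 $ 3 - M $ 2 $ 3 * M $ 3 $ 2)\<^sup>2 \<le> det M"
proof -
  define M' where "M' S = rot U ** bloch_matrix S ** rot V" for S
  have cont: "continuous_on UNIV (\<lambda>S. M' S $ i $ j)" for i j
    unfolding M'_def matrix_mult_3
    by (intro continuous_on_add continuous_on_diff continuous_on_mult continuous_on_const continuous_on_bloch_matrix)
  define C where "C i j = {S. (M' S $ i $ i * M' S $ j $ j - M' S $ i $ j * M' S $ j $ i)\<^sup>2 \<le> det (M' S)}" for i j
  have "closed (C i j)" for i j
    unfolding C_def det_3
    by (intro closed_Collect_le continuous_on_power continuous_on_add continuous_on_diff continuous_on_mult continuous_on_const cont)
  moreover have "L_CP \<subseteq> C 1 2 \<inter> C 1 3 \<inter> C 2 3"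
  proof
    fix S assume "S \<in> L_CP"
    then have "det_dominated 0 (M' S)"
      unfolding M'_def by (intro det_dominated_mult det_dominated_rot det_dominated_L_CP assms)
    from det_dominated_minors[OF this] show "S \<in> C 1 2 \<inter> C 1 3 \<inter> C 2 3"
      by (simp add: C_def)
  qed
  ultimately have "closure L_CP \<subseteq> C 1 2 \<inter> C 1 3 \<inter> C 2 3"
    by (intro closure_minimal closed_Int)
  then have "T \<in> C 1 2 \<inter> C 1 3 \<inter> C 2 3"
    using assms(1) by blast
  then show minors: "(M $ 1 $ 1 * M $ 2 $ 2 - M $ 1 $ 2 * M $ 2 $ 1)\<^sup>2 \<le> det M"
    "(M $ 1 $ 1 * M $ 3 $ 3 - M $ 1 $ 3 * M $ 3 $ 1)\<^sup>2 \<le> det M"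
    "(M $ 2 $ 2 * M $ 3 $ 3 - M $ 2 $ 3 * M $ 3 $ 2)\<^sup>2 \<le> det M"
    by (simp_all add: C_def M'_def M_def)
  show "0 \<le> det M"
    using minors(1) by (rule order_trans[rotated]) simp
qed

section \<open>Maps diagonal in the Pauli basis\<close>

definition pauli_projection :: "nat \<Rightarrow> qmap" where
  "pauli_projection k = Blinfun (\<lambda>A. cscale (trace (pauli k ** A) / 2) (pauli k))"

text \<open>The parameters are the eigenvalues on the four Pauli matrices; \<open>t = 1\<close> is
  used for channels and \<open>t = 0\<close> for generators.\<close>

definition pauli_diagonal :: "real \<Rightarrow> real \<Rightarrow> real \<Rightarrow> real \<Rightarrow> qmap" where
  "pauli_diagonal t a b c = t *\<^sub>R pauli_projection 0 + a *\<^sub>R pauli_projection 1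
     + b *\<^sub>R pauli_projection 2 + c *\<^sub>R pauli_projection 3"

lemma pauli_projection_apply:
  "blinfun_apply (pauli_projection k) A = cscale (trace (pauli k ** A) / 2) (pauli k)"
  unfolding pauli_projection_def
  by (subst bounded_linear_Blinfun_apply)
     (auto intro!: bounded_linear_qop linearI
       simp: qop_eq_iff qop_mult_component trace_qop scaleR_conv_of_real[where 'a = complex] field_simps)

lemma pauli_diagonal_component:
  "blinfun_apply (pauli_diagonal t a b c) A $ 1 $ 1 =
     t * (A $ 1 $ 1 + A $ 2 $ 2) / 2 + c * (A $ 1 $ 1 - A $ 2 $ 2) / 2"
  "blinfun_apply (pauli_diagonal t a b c) A $ 2 $ 2 =
     t * (A $ 1 $ 1 + A $ 2 $ 2) / 2 - c * (A $ 1 $ 1 - A $ 2 $ 2) / 2"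
  "blinfun_apply (pauli_diagonal t a b c) A $ 1 $ 2 =
     a * (A $ 1 $ 2 + A $ 2 $ 1) / 2 + b * (A $ 1 $ 2 - A $ 2 $ 1) / 2"
  "blinfun_apply (pauli_diagonal t a b c) A $ 2 $ 1 =
     a * (A $ 1 $ 2 + A $ 2 $ 1) / 2 - b * (A $ 1 $ 2 - A $ 2 $ 1) / 2"
  by (simp_all add: pauli_diagonal_def blinfun.add_left blinfun.scaleR_left pauli_projection_apply
      pauli_def qop_mult_component trace_qop mat_qop_component scaleR_conv_of_real[where 'a = complex] field_simps)

lemma pauli_diagonal_compose:
  "pauli_diagonal t a b c o\<^sub>L pauli_diagonal t' a' b' c' = pauli_diagonal (t * t') (a * a') (b * b') (c * c')"
  by (rule blinfun_eqI) (simp add: qop_eq_iff pauli_diagonal_component field_simps)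

lemma pauli_diagonal_1: "pauli_diagonal 1 1 1 1 = id_blinfun"
  by (rule blinfun_eqI) (simp add: qop_eq_iff pauli_diagonal_component field_simps)

lemma pauli_diagonal_power:
  "((o\<^sub>L) (pauli_diagonal t a b c) ^^ n) id_blinfun = pauli_diagonal (t ^ n) (a ^ n) (b ^ n) (c ^ n)"
  by (induction n) (simp_all add: pauli_diagonal_1 pauli_diagonal_compose)

text \<open>Powers act on the eigenvalues, so the series splits into four scalar exponential
  series.\<close>

lemma qexp_pauli_diagonal:
  "qexp (pauli_diagonal t a b c) = pauli_diagonal (exp t) (exp a) (exp b) (exp c)"
proof -
  have "(\<lambda>n. (x ^ n /\<^sub>R fact n) *\<^sub>R Q) sums (exp x *\<^sub>R Q)" for x :: real and Q :: qmap
    by (rule bounded_linear.sums[OF bounded_linear_scaleR_left exp_converges])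
  then have "(\<lambda>n. (t ^ n /\<^sub>R fact n) *\<^sub>R pauli_projection 0 + (a ^ n /\<^sub>R fact n) *\<^sub>R pauli_projection 1
      + (b ^ n /\<^sub>R fact n) *\<^sub>R pauli_projection 2 + (c ^ n /\<^sub>R fact n) *\<^sub>R pauli_projection 3)
    sums pauli_diagonal (exp t) (exp a) (exp b) (exp c)"
    unfolding pauli_diagonal_def by (intro sums_add)
  then have "(\<lambda>n. pauli_diagonal (t ^ n) (a ^ n) (b ^ n) (c ^ n) /\<^sub>R fact n)
    sums pauli_diagonal (exp t) (exp a) (exp b) (exp c)"
    by (simp add: pauli_diagonal_def scaleR_add_right)
  then show ?thesis
    unfolding qexp_def pauli_diagonal_power by (rule sums_unique[symmetric])
qed

lemma bloch_matrix_pauli_diagonal: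
  "bloch_matrix (pauli_diagonal t a b c) = vector [vector [a, 0, 0], vector [0, b, 0], vector [0, 0, c]]"
  by (simp add: vec_eq_iff forall_3 bloch_matrix_component bloch_vec_component
      pauli_diagonal_component bloch_op_component axis_def)

lemma unital_pauli_diagonal: "unital (pauli_diagonal 1 a b c)"
  by (simp add: unital_def qop_eq_iff pauli_diagonal_component mat_qop_component)

lemma sum_lessThan_3: "(\<Sum>i<3. f i) = f 0 + f 1 + f (2 :: nat)"
  for f :: "nat \<Rightarrow> 'a :: comm_monoid_add"
  by (simp add: eval_nat_numeral add_ac)

lemma sum_lessThan_4: "(\<Sum>i<4. f i) = f 0 + f 1 + f 2 + f (3 :: nat)"
  for f :: "nat \<Rightarrow> 'a :: comm_monoid_add"
  by (simp add: eval_nat_numeral add_ac)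

lemma dagger_pauli: "dagger (pauli k) = pauli k"
  by (simp add: pauli_def qop_eq_iff mat_qop_component)

text \<open>Conjugation by a Pauli matrix multiplies each Pauli matrix by a sign. Inverting this
  sign transform expresses the weights through the eigenvalues; the hypotheses are four times the
  weights.\<close>

lemma pauli_channel_pauli_diagonal:
  assumes "0 \<le> 1 + a + b + c" "0 \<le> 1 + a - b - c" "0 \<le> 1 - a + b - c" "0 \<le> 1 - a - b + c"
  shows "pauli_channel (pauli_diagonal 1 a b c)"
proof -
  define p :: "nat \<Rightarrow> real" where "p k = (if k = 0 then 1 + a + b + c else if k = 1 then 1 + a - b - c
    else if k = 2 then 1 - a + b - c else 1 - a - b + c) / 4" for k
  have p: "0 \<le> p k" for k
    using assms by (simp add: p_def)
  have apply_eq: "blinfun_apply (pauli_diagonal 1 a b c) A = (\<Sum>i<4. p i *\<^sub>R (pauli i ** A ** pauli i))" for A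
    by (simp add: sum_lessThan_4 qop_eq_iff pauli_diagonal_component qop_mult_component p_def
        pauli_def mat_qop_component scaleR_conv_of_real[where 'a = complex] field_simps)
  have "completely_positive (pauli_diagonal 1 a b c)"
    unfolding completely_positive_def
  proof (intro allI impI)
    fix n X assume X: "block_psd n X"
    have "psd ({..<n} \<times> UNIV) (\<lambda>x y. \<Sum>k<4. p k *
        (case x of (i, a) \<Rightarrow> \<lambda>(j, b). (pauli k ** X i j ** dagger (pauli k)) $ a $ b) y)"
      using block_psd_conjugation[OF X] p by (intro psd_weighted_sum) (auto simp: block_psd_def)
    also have "(\<lambda>x y. \<Sum>k<4. p k *
        (case x of (i, a) \<Rightarrow> \<lambda>(j, b). (pauli k ** X i j ** dagger (pauli k)) $ a $ b) y) =
        (\<lambda>(i, a') (j, b'). blinfun_apply (pauli_diagonal 1 a b c) (X i j) $ a' $ b')"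
      unfolding apply_eq by (simp add: fun_eq_iff dagger_pauli sum_lessThan_4 scaleR_conv_of_real[where 'a = complex])
    finally show "block_psd n (\<lambda>i j. blinfun_apply (pauli_diagonal 1 a b c) (X i j))"
      by (simp add: block_psd_def)
  qed
  moreover have "trace_preserving (pauli_diagonal 1 a b c)"
    by (simp add: trace_preserving_def trace_qop pauli_diagonal_component)
  moreover have "Vector_Spaces.linear cscale cscale (blinfun_apply (pauli_diagonal 1 a b c))"
    by (simp add: cscale_linear_iff blinfun.add_right qop_eq_iff pauli_diagonal_component field_simps)
  moreover have "(\<Sum>i<4. p i) = 1"
    by (simp add: sum_lessThan_4 p_def field_simps)
  ultimately show ?thesis
    unfolding pauli_channel_def channel_def using p apply_eq by blast
qed

lemma nonsingular_pauli_diagonal: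
  assumes "t \<noteq> 0" "a \<noteq> 0" "b \<noteq> 0" "c \<noteq> 0"
  shows "\<not> singular (pauli_diagonal t a b c)"
proof -
  let ?D = "pauli_diagonal t a b c" and ?I = "pauli_diagonal (1 / t) (1 / a) (1 / b) (1 / c)"
  have "?D o\<^sub>L ?I = id_blinfun" "?I o\<^sub>L ?D = id_blinfun"
    using assms by (simp_all add: pauli_diagonal_compose pauli_diagonal_1)
  then have "blinfun_apply ?D (blinfun_apply ?I A) = A" "blinfun_apply ?I (blinfun_apply ?D A) = A" for A
    by (metis blinfun_apply_blinfun_compose blinfun_apply_id_blinfun id_apply)+
  then have "bij (blinfun_apply ?D)"
    by (intro o_bij[of "blinfun_apply ?I"]) (auto simp: fun_eq_iff)
  then show ?thesis
    by (simp add: singular_def)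
qed

text \<open>A Pauli jump operator with rate \<open>x\<close> annihilates the identity and itself and
  multiplies the other two Pauli matrices by \<open>-2 x\<close>. The Hamiltonian is zero.\<close>

lemma lindblad_generator_pauli_diagonal:
  fixes x y z :: real
  assumes "0 \<le> x" "0 \<le> y" "0 \<le> z"
  shows "lindblad_generator (pauli_diagonal 0 (-2 * (y + z)) (-2 * (x + z)) (-2 * (x + y)))"
proof -
  define g :: "nat \<Rightarrow> real" where "g i = (if i = 0 then x else if i = 1 then y else z)" for i
  define G :: "nat \<Rightarrow> nat \<Rightarrow> complex" where "G i j = (if i = j then of_real (g i) else 0)" for i j
  have "psd {..<3} G"
    unfolding psd_def
  proof (intro conjI ballI allI)
    fix v :: "nat \<Rightarrow> complex"
    have "Re (\<Sum>i<3. \<Sum>j<3. cnj (v i) * G i j * v j) = (\<Sum>i<3. g i * ((Re (v i))\<^sup>2 + (Im (v i))\<^sup>2))"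
      by (simp add: sum_lessThan_3 G_def power2_eq_square algebra_simps)
    also have "0 \<le> \<dots>"
      using assms by (intro sum_nonneg) (simp add: g_def)
    finally show "0 \<le> Re (\<Sum>i<3. \<Sum>j<3. cnj (v i) * G i j * v j)" .
  qed (simp add: G_def)
  moreover have "hermitian 0"
    by (simp add: hermitian_def qop_eq_iff)
  moreover have "blinfun_apply (pauli_diagonal 0 (-2 * (y + z)) (-2 * (x + z)) (-2 * (x + y))) A =
      cscale \<i> (A ** 0 - 0 ** A) +
      (\<Sum>i<3. \<Sum>j<3. cscale (G i j) (pauli (Suc i) ** A ** dagger (pauli (Suc j))
        - (1/2) *\<^sub>R (dagger (pauli (Suc j)) ** pauli (Suc i) ** A + A ** (dagger (pauli (Suc j)) ** pauli (Suc i)))))"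
    for A
    unfolding sum_lessThan_3
    by (simp add: G_def g_def qop_eq_iff pauli_diagonal_component qop_mult_component
        pauli_def mat_qop_component scaleR_conv_of_real[where 'a = complex] field_simps)
  ultimately show ?thesis
    unfolding lindblad_generator_def
    by (intro exI[of _ 0] exI[of _ 3] exI[of _ "\<lambda>i. pauli (Suc i)"] exI[of _ G]) simp
qed

text \<open>Logarithms turn the product inequalities into linear ones; \<open>x\<close>,
  \<open>y\<close>, \<open>z\<close> solve the linear system that equates the generator's
  eigenvalues with \<open>ln a\<close>, \<open>ln b\<close>, \<open>ln c\<close>.\<close>

lemma pauli_diagonal_eq_qexp:
  assumes "0 < a" "0 < b" "0 < c" "a * b \<le> c" "a * c \<le> b" "b * c \<le> a"
  shows "\<exists>L. lindblad_generator L \<and> pauli_diagonal 1 a b c = qexp L"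
proof -
  define x y z where "x = (ln a - ln b - ln c) / 4" and "y = (ln b - ln a - ln c) / 4"
    and "z = (ln c - ln a - ln b) / 4"
  have "ln (b * c) \<le> ln a" "ln (a * c) \<le> ln b" "ln (a * b) \<le> ln c"
    using assms by simp_all
  then have "ln b + ln c \<le> ln a" "ln a + ln c \<le> ln b" "ln a + ln b \<le> ln c"
    using assms by (simp_all add: ln_mult)
  then have "lindblad_generator (pauli_diagonal 0 (-2 * (y + z)) (-2 * (x + z)) (-2 * (x + y)))"
    by (intro lindblad_generator_pauli_diagonal) (simp_all add: x_def y_def z_def)
  moreover have "-2 * (y + z) = ln a" "-2 * (x + z) = ln b" "-2 * (x + y) = ln c"
    by (simp_all add: x_def y_def z_def field_simps)
  ultimately show ?thesis
    using assms by (intro exI[of _ "pauli_diagonal 0 (ln a) (ln b) (ln c)"])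
      (simp add: qexp_pauli_diagonal)
qed

text \<open>For instance, \<open>b + c \<le> 1 + b c \<le> 1 + a\<close>, the first step being
  \<open>0 \<le> (1 - b) (1 - c)\<close>.\<close>

lemma pauli_channel_of_mult_le:
  assumes "0 \<le> a" "0 \<le> b" "0 \<le> c" "a \<le> 1" "b \<le> 1" "c \<le> 1"
    and "a * b \<le> c" "a * c \<le> b" "b * c \<le> a"
  shows "pauli_channel (pauli_diagonal 1 a b c)"
proof (rule pauli_channel_pauli_diagonal)
  have "0 \<le> (1 - b) * (1 - c)" "0 \<le> (1 - a) * (1 - c)" "0 \<le> (1 - a) * (1 - b)"
    using assms by simp_all
  then show "0 \<le> 1 + a - b - c" "0 \<le> 1 - a + b - c" "0 \<le> 1 - a - b + c"
    using assms by (simp_all add: algebra_simps)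
qed (use assms in simp)

text \<open>If a factor is raised to \<open>\<delta>\<close>, the product is at most
  \<open>\<delta>\<close> because the other factor is at most 1; otherwise the hypothesis applies
  unchanged.\<close>

lemma max_mult_le:
  fixes a b c \<delta> :: real
  assumes "0 \<le> a" "0 \<le> b" "a \<le> 1" "b \<le> 1" "a * b \<le> c" "0 < \<delta>" "\<delta> < 1"
  shows "max a \<delta> * max b \<delta> \<le> max c \<delta>"
proof (cases "\<delta> \<le> a \<and> \<delta> \<le> b")
  case True
  then have "max a \<delta> = a" "max b \<delta> = b"
    by simp_all
  then show ?thesis
    using assms by (simp add: le_max_iff_disj)
next
  case False
  have "x * y \<le> min x y" if "0 \<le> x" "x \<le> 1" "0 \<le> y" "y \<le> 1" for x y :: real
    using that by (simp add: mult_left_le mult_left_le_one_le)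
  from this[of "max a \<delta>" "max b \<delta>"] have "max a \<delta> * max b \<delta> \<le> min (max a \<delta>) (max b \<delta>)"
    using assms by simp
  also have "\<dots> \<le> max c \<delta>"
    using False by (auto simp: max_def min_def)
  finally show ?thesis .
qed

text \<open>Raising all eigenvalues to at least \<open>\<delta>\<close> makes the map invertible and preserves the
  inequalities between products.\<close>
lemma L_divisible_pauli_diagonal:
  assumes "0 \<le> a" "0 \<le> b" "0 \<le> c" "a \<le> 1" "b \<le> 1" "c \<le> 1"
    and "a * b \<le> c" "a * c \<le> b" "b * c \<le> a"
  shows "L_divisible (pauli_diagonal 1 a b c)"
  unfolding L_divisible_def
proof
  show "channel (pauli_diagonal 1 a b c)"
    using pauli_channel_of_mult_le[OF assms] by (simp add: pauli_channel_def)
  let ?S = "{T. channel T \<and> \<not> singular T \<and> (\<exists>L. lindblad_generator L \<and> T = qexp L)}"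
  \<comment> \<open>The double successor keeps \<open>\<delta> n\<close> at most one half, strictly
    below 1 as \<open>max_mult_le\<close> requires.\<close>
  define \<delta> :: "nat \<Rightarrow> real" where "\<delta> n = inverse (real (Suc (Suc n)))" for n
  define T where "T n = pauli_diagonal 1 (max a (\<delta> n)) (max b (\<delta> n)) (max c (\<delta> n))" for n
  have "T n \<in> ?S" for n
  proof -
    have \<delta>: "0 < \<delta> n" "\<delta> n < 1"
      by (simp_all add: \<delta>_def inverse_eq_divide)
    have prods: "max a (\<delta> n) * max b (\<delta> n) \<le> max c (\<delta> n)" "max a (\<delta> n) * max c (\<delta> n) \<le> max b (\<delta> n)"
      "max b (\<delta> n) * max c (\<delta> n) \<le> max a (\<delta> n)"
      using assms \<delta> by (auto intro!: max_mult_le)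
    have pos: "0 < max x (\<delta> n)" for x
      using \<delta> by (simp add: less_max_iff_disj)
    have "channel (T n)"
      using pauli_channel_of_mult_le[OF pos[THEN less_imp_le] pos[THEN less_imp_le] pos[THEN less_imp_le]
          _ _ _ prods] assms \<delta> by (simp add: T_def pauli_channel_def)
    moreover have "\<not> singular (T n)"
      unfolding T_def using pos by (intro nonsingular_pauli_diagonal) (auto simp: less_le)
    ultimately show ?thesis
      using pauli_diagonal_eq_qexp[OF pos pos pos prods] by (simp add: T_def)
  qed
  moreover have "T \<longlonglongrightarrow> pauli_diagonal 1 a b c"
  proof -
    have "\<delta> \<longlonglongrightarrow> 0"
      unfolding \<delta>_def by (rule LIMSEQ_Suc[OF LIMSEQ_inverse_real_of_nat])
    then have max: "(\<lambda>n. max x (\<delta> n)) \<longlonglongrightarrow> x" if "0 \<le> x" for x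
      using tendsto_max[OF tendsto_const[of x], of \<delta> 0] that by simp
    show ?thesis
      unfolding T_def pauli_diagonal_def by (intro tendsto_intros max assms)
  qed
  ultimately show "pauli_diagonal 1 a b c \<in> closure ?S"
    unfolding closure_sequential by blast
qed

lemma nonsingular_pauli_diagonalD:
  assumes "\<not> singular (pauli_diagonal t a b c)"
  shows "a \<noteq> 0" "b \<noteq> 0" "c \<noteq> 0"
proof -
  have inj: "A = 0" if "blinfun_apply (pauli_diagonal t a b c) A = 0" for A
    using assms that by (metis singular_def bij_is_inj injD blinfun.zero_right)
  show "a \<noteq> 0"
    using inj[of "pauli 1"]
    by (auto simp: qop_eq_iff pauli_diagonal_component pauli_simps mat_qop_component)
  show "b \<noteq> 0"
    using inj[of "pauli 2"]
    by (auto simp: qop_eq_iff pauli_diagonal_component pauli_simps mat_qop_component)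
  show "c \<noteq> 0"
    using inj[of "pauli 3"]
    by (auto simp: qop_eq_iff pauli_diagonal_component pauli_simps mat_qop_component)
qed

section \<open>Transport along unitary conjugations and assembly of the decomposition\<close>

lemma unital_unitary_sandwich:
  assumes "unital E" "unitary U" "unitary V"
  shows "unital (conjugation U o\<^sub>L E o\<^sub>L conjugation V)"
  using assms by (simp add: unital_def unitary_def)

lemma singular_unitary_sandwich:
  assumes "\<not> singular E" "unitary U" "unitary V"
  shows "\<not> singular (conjugation U o\<^sub>L E o\<^sub>L conjugation V)"
proof -
  have "bij (blinfun_apply (conjugation W))" if "unitary W" for W
  proof (rule o_bij[of "blinfun_apply (conjugation (dagger W))"])
    show "blinfun_apply (conjugation (dagger W)) \<circ> blinfun_apply (conjugation W) = id"
      "blinfun_apply (conjugation W) \<circ> blinfun_apply (conjugation (dagger W)) = id"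
      using conjugation_inverse[OF that]
      by (metis blinfun_compose.rep_eq id_blinfun.rep_eq eq_id_iff)+
  qed
  then have "bij (blinfun_apply (conjugation U) \<circ> blinfun_apply E \<circ> blinfun_apply (conjugation V))"
    using assms by (intro bij_comp) (auto simp: singular_def)
  then show ?thesis
    by (simp add: singular_def o_def blinfun_compose.rep_eq)
qed

text \<open>This cancels \<open>a * b\<close> in a minor bound for a diagonal matrix; when the
  product vanishes, the claim is just \<open>0 \<le> c\<close>.\<close>

lemma mult_le_of_square_le:
  fixes a b c :: real
  assumes "0 \<le> a" "0 \<le> b" "0 \<le> c" "(a * b)\<^sup>2 \<le> (a * b) * c"
  shows "a * b \<le> c"
proof (cases "a * b = 0")
  case False
  then have "0 < a * b"
    using assms by (simp add: less_le)
  then show ?thesis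
    using assms(4) unfolding power2_eq_square by (simp only: mult_le_cancel_left_pos)
qed (use assms in auto)

theorem theorem18:
  fixes E :: qmap
  assumes "channel E" and "unital E" and "infinitesimal_divisible E"
  shows "\<exists>P U1 U2. pauli_channel P \<and> L_divisible P \<and>
           unitary_conjugation U1 \<and> unitary_conjugation U2 \<and>
           E = U1 o\<^sub>L P o\<^sub>L U2 \<and>
           (\<not> singular E \<longrightarrow> (\<exists>L. lindblad_generator L \<and> P = qexp L))"
proof -
  have E: "E \<in> closure L_CP"
    using assms(3) by (simp add: infinitesimal_divisible_def)
  have "unitary (mat 1)"
    by (simp add: unitary_def)
  then have "0 \<le> det (bloch_matrix E)"
    using minors_closure_L_CP(1)[OF E, of "mat 1" "mat 1"] by simp
  from channel_singular_value_decomposition[OF assms(1) this] obtain U V s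
    where U: "unitary U" and V: "unitary V"
      and diag: "\<forall>i j. (rot U ** bloch_matrix E ** rot V) $ i $ j = (if i = j then s i else 0)"
      and s: "\<forall>i. 0 \<le> s i \<and> s i \<le> 1"
    by metis
  define P where "P = pauli_diagonal 1 (s 1) (s 2) (s 3)"
  note minors = minors_closure_L_CP(2-4)[OF E U V]
  \<comment> \<open>For the diagonalised Bloch matrix, the minors are products of two singular
    values and the determinant is the product of all three.\<close>
  have prods: "s 1 * s 2 \<le> s 3" "s 1 * s 3 \<le> s 2" "s 2 * s 3 \<le> s 1"
    using minors s by (auto simp: det_3 diag mult_ac intro!: mult_le_of_square_le)
  have P: "pauli_channel P" "L_divisible P"
    unfolding P_def using s prods
    by (auto intro!: pauli_channel_of_mult_le L_divisible_pauli_diagonal)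
  \<comment> \<open>Both sides are unital, so no translation remains and equality of Bloch matrices
    is enough.\<close>
  have UEV: "conjugation U o\<^sub>L E o\<^sub>L conjugation V = P"
  proof (rule unital_channel_eqI)
    show "channel (conjugation U o\<^sub>L E o\<^sub>L conjugation V)"
      by (intro channel_compose channel_conjugation assms U V)
    show "unital (conjugation U o\<^sub>L E o\<^sub>L conjugation V)"
      by (rule unital_unitary_sandwich[OF assms(2) U V])
    show "channel P"
      using P(1) by (simp add: pauli_channel_def)
    show "unital P"
      by (simp add: P_def unital_pauli_diagonal)
    show "bloch_matrix (conjugation U o\<^sub>L E o\<^sub>L conjugation V) = bloch_matrix P"
      by (simp add: bloch_matrix_sandwich[OF assms(1) V] P_def bloch_matrix_pauli_diagonal
          vec_eq_iff forall_3 diag)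
  qed
  have "E = (conjugation (dagger U) o\<^sub>L conjugation U) o\<^sub>L E o\<^sub>L (conjugation V o\<^sub>L conjugation (dagger V))"
    unfolding conjugation_inverse[OF U] conjugation_inverse[OF V] by (rule blinfun_eqI) simp
  also have "\<dots> = conjugation (dagger U) o\<^sub>L P o\<^sub>L conjugation (dagger V)"
    unfolding UEV[symmetric] by (rule blinfun_eqI) simp
  finally have "E = conjugation (dagger U) o\<^sub>L P o\<^sub>L conjugation (dagger V)" .
  moreover have "\<exists>L. lindblad_generator L \<and> P = qexp L" if "\<not> singular E"
  proof -
    have "\<not> singular P"
      using singular_unitary_sandwich[OF that U V] by (simp add: UEV)
    then have "s 1 \<noteq> 0" "s 2 \<noteq> 0" "s 3 \<noteq> 0"
      unfolding P_def by (rule nonsingular_pauli_diagonalD)+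
    then have "0 < s 1" "0 < s 2" "0 < s 3"
      using s by (simp_all add: less_le)
    then show ?thesis
      unfolding P_def using prods by (rule pauli_diagonal_eq_qexp)
  qed
  ultimately show ?thesis
    using P unitary_conjugation_conjugation[OF unitary_dagger] U V by blast
qed

end
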